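(* Assume $\mathfrak{b}\le\omega_1$. Then the following statements hold. (1) If $X$ is a stratifiable $k$-space with a point-countable $k$-network and $S_\omega\times X$ is a $k_R$-space, then $X$ is a locally $\sigma$-compact space; in particular, if $X$ has a compact-countable $k$-network, then $X$ is a locally $k_\omega$-space. (2) If $X$ is a stratifiable $k$-space with a point-countable $k$-network and $S_{\omega_1}\times X$ is a $k_R$-space, then $X$ is a locally compact space. (3) If both $X$ and $Y$ are stratifiable $k$-spaces with a compact-countable $k$-network, then $X\times Y$ is a $k_R$-space if and only if the pair $(X,Y)$ satisfies Tanaka's conditions.
   Context: All spaces are assumed to be Tychonoff. For an infinite cardinal $\kappa$, the sequential fan $S_\kappa$ is the quotient of the topological sum $\bigoplus_{\alpha\in\kappa}(T_\alpha\cup\{x_\alpha\})$, where each $T_\alpha$ is a (non-trivial) sequence converging to $x_\alpha\notin T_\alpha$, obtained by identifying all the points $x_\alpha$ to one point. A space $X$ is a $k$-space if a subset $C\subseteq X$ is closed whenever $C\cap K$ is closed in $K$ for every compact $K\subseteq X$. $X$ is a $k_R$-space if $X$ is Tychonoff and every $f:X\to\mathbb{R}$ whose restriction to each compact subset is continuous is continuous. $X$ is a $k_\omega$-space if there is a countable family $\{K_n:n\in\mathbb{N}\}$ of compact subsets of $X$ such that $F\subseteq X$ is closed whenever $F\cap K_n$ is closed in $K_n$ for each $n$. $X$ is locally compact (resp. locally $\sigma$-compact, locally $k_\omega$) if every point of $X$ has a compact (resp. $\sigma$-compact, $k_\omega$-) neighbourhood. $X$ is stratifiable if to each open $U\subseteq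 X$ one can assign a sequence $\{U_n\}_{n=1}^\infty$ of open subsets of $X$ such that (a) $\overline{U_n}\subseteq U$; (b) $\bigcup_{n}U_n=U$; (c) $U_n\subseteq V_n$ for all $n$ whenever $U\subseteq V$. A family $\mathscr{P}$ of subsets of $X$ is a $k$-network if for every compact $K$ and every open $U\supseteq K$ there is a finite $\mathscr{P}'\subseteq\mathscr{P}$ with $K\subseteq\bigcup\mathscr{P}'\subseteq U$. A family is point-countable (resp. compact-countable) if each point belongs to (resp. each compact subset meets) at most countably many of its members. The pair $(X,Y)$ satisfies Tanaka's conditions if one of the following holds: (i) both $X$ and $Y$ are first-countable; (ii) both $X$ and $Y$ are $k$-spaces and $X$ or $Y$ is locally compact; (iii) both $X$ and $Y$ are locally $k_\omega$-spaces. $\mathfrak{b}$ is the smallest cardinality of a family $\mathscr{H}\subseteq{}^\omega\omega$ that is unbounded, i.e. such that there is no $g\in{}^\omega\omega$ with, for every $f\in\mathscr{H}$, $f(n)\le g(n)$ for all but finitely many $n$. *)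

theory Defs
  imports "HOL-Analysis.Analysis"
begin

unbundle cardinal_syntax

section \<open>The cardinals\<close>

abbreviation omega1 :: "nat set rel" where
  "omega1 \<equiv> cardSuc natLeq"

definition unbounded_family :: "(nat \<Rightarrow> nat) set \<Rightarrow> bool" where
  "unbounded_family H \<longleftrightarrow> \<not> (\<exists>g. \<forall>f\<in>H. \<forall>\<^sub>\<infinity>n. f n \<le> g n)"

definition bounding_number :: "(nat \<Rightarrow> nat) rel" where
  "bounding_number =
     |SOME H. unbounded_family H \<and> (\<forall>H'. unbounded_family H' \<longrightarrow> |H| \<le>o |H'| )|"

lemma unbounded_family_UNIV: "unbounded_family UNIV"
proof -
  have "\<not> (\<forall>\<^sub>\<infinity>n. Suc (g n) \<le> g n)" for g :: "nat \<Rightarrow> nat"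
    by simp
  then show ?thesis
    unfolding unbounded_family_def by (metis UNIV_I)
qed

text \<open>The choice in the definition of the bounding number is never vacuous.\<close>

lemma bounding_number:
  shows "\<exists>H. unbounded_family H \<and> bounding_number = |H|"
    and "unbounded_family H' \<Longrightarrow> bounding_number \<le>o |H'|"
proof -
  let ?P = "\<lambda>H. unbounded_family H \<and> (\<forall>H'. unbounded_family H' \<longrightarrow> |H| \<le>o |H'| )"
  have "\<exists>r \<in> card_of ` Collect unbounded_family.
          \<forall>r' \<in> card_of ` Collect unbounded_family. r \<le>o r'"
    by (rule exists_minim_Card_order) (use unbounded_family_UNIV in \<open>auto simp: card_of_Card_order\<close>)
  then have "\<exists>H. ?P H" by auto
  then have *: "?P (SOME H. ?P H)" by (rule someI_ex)
  then show "\<exists>H. unbounded_family H \<and> bounding_number = |H|"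
    unfolding bounding_number_def by blast
  from * show "unbounded_family H' \<Longrightarrow> bounding_number \<le>o |H'|"
    unfolding bounding_number_def by blast
qed

section \<open>Sequential fans\<close>

definition quotient_topology :: "'a topology \<Rightarrow> ('a \<Rightarrow> 'b) \<Rightarrow> 'b topology" where
  "quotient_topology X f =
     topology (\<lambda>U. U \<subseteq> f ` topspace X \<and> openin X {x \<in> topspace X. f x \<in> U})"

lemma openin_quotient_topology:
  "openin (quotient_topology X f) U \<longleftrightarrow>
     U \<subseteq> f ` topspace X \<and> openin X {x \<in> topspace X. f x \<in> U}"
proof -
  have 1: "{x \<in> topspace X. f x \<in> S \<inter> T} = {x \<in> topspace X. f x \<in> S} \<inter> {x \<in> topspace X. f x \<in> T}" for S T
    by auto
  have 2: "{x \<in> topspace X. f x \<in> \<Union>\<K>} = (\<Union>K\<in>\<K>. {x \<in> topspace X. f x \<in> K})" for \<K>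
    by auto
  have "istopology (\<lambda>U. U \<subseteq> f ` topspace X \<and> openin X {x \<in> topspace X. f x \<in> U})"
    unfolding istopology_def 1 2 by blast
  then show ?thesis
    by (simp add: quotient_topology_def)
qed

lemma topspace_quotient_topology [simp]: "topspace (quotient_topology X f) = f ` topspace X"
proof -
  have "{x \<in> topspace X. f x \<in> f ` topspace X} = topspace X" by auto
  then have "openin (quotient_topology X f) (f ` topspace X)"
    by (simp add: openin_quotient_topology)
  then show ?thesis
    by (metis openin_quotient_topology openin_subset openin_topspace subset_antisym)
qed

lemma quotient_map_quotient_topology: "quotient_map X (quotient_topology X f) f"
  by (auto simp: quotient_map_def openin_quotient_topology)

text \<open>A nontrivial convergent sequence with its limit: \<open>Some n\<close> is the \<open>n\<close>-th term, \<open>None\<close> the limit.\<close>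

definition convergent_sequence :: "nat option topology" where
  "convergent_sequence = Alexandroff_compactification (discrete_topology UNIV)"

text \<open>In the fan, \<open>None\<close> is the point to which all the limits \<open>(i, None)\<close> are identified.\<close>

fun fan_map :: "'i \<times> nat option \<Rightarrow> ('i \<times> nat) option" where
  "fan_map (i, None) = None"
| "fan_map (i, Some n) = Some (i, n)"

definition sequential_fan :: "'i set \<Rightarrow> ('i \<times> nat) option topology" where
  "sequential_fan I = quotient_topology (sum_topology (\<lambda>i. convergent_sequence) I) fan_map"

abbreviation S_omega :: "(nat \<times> nat) option topology" where
  "S_omega \<equiv> sequential_fan UNIV"

text \<open>\<open>omega1\<close> is a well-order on its field, a set of cardinality \<open>\<aleph>\<^sub>1\<close>.\<close>

abbreviation S_omega1 :: "(nat set \<times> nat) option topology" where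
  "S_omega1 \<equiv> sequential_fan (Field omega1)"

section \<open>Classes of spaces\<close>

definition tychonoff_space :: "'a topology \<Rightarrow> bool" where
  "tychonoff_space X \<longleftrightarrow> completely_regular_space X \<and> t1_space X"

definition kR_space :: "'a topology \<Rightarrow> bool" where
  "kR_space X \<longleftrightarrow> tychonoff_space X \<and>
     (\<forall>f :: 'a \<Rightarrow> real.
        (\<forall>K. compactin X K \<longrightarrow> continuous_map (subtopology X K) euclideanreal f)
          \<longrightarrow> continuous_map X euclideanreal f)"

text \<open>
  As in the source, the compact sets are not explicitly required to cover the space. The points
  outside their union form a clopen discrete subspace, so that \<open>locally_k_omega_space\<close> below
  is the same with or without such a requirement.
\<close>

definition k_omega_space :: "'a topology \<Rightarrow> bool" where
  "k_omega_space X \<longleftrightarrow>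
     (\<exists>K :: nat \<Rightarrow> 'a set. (\<forall>n. compactin X (K n)) \<and>
        (\<forall>F. F \<subseteq> topspace X \<and> (\<forall>n. closedin (subtopology X (K n)) (F \<inter> K n))
          \<longrightarrow> closedin X F))"

definition sigma_compact_space :: "'a topology \<Rightarrow> bool" where
  "sigma_compact_space X \<longleftrightarrow>
     (\<exists>K :: nat \<Rightarrow> 'a set. (\<forall>n. compactin X (K n)) \<and> topspace X = (\<Union>n. K n))"

text \<open>Neighbourhoods need not be open.\<close>

definition locally_sigma_compact_space :: "'a topology \<Rightarrow> bool" where
  "locally_sigma_compact_space X \<longleftrightarrow>
     (\<forall>x \<in> topspace X. \<exists>U N. openin X U \<and> x \<in> U \<and> U \<subseteq> N \<and> N \<subseteq> topspace X \<and>
        sigma_compact_space (subtopology X N))"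

definition locally_k_omega_space :: "'a topology \<Rightarrow> bool" where
  "locally_k_omega_space X \<longleftrightarrow>
     (\<forall>x \<in> topspace X. \<exists>U N. openin X U \<and> x \<in> U \<and> U \<subseteq> N \<and> N \<subseteq> topspace X \<and>
        k_omega_space (subtopology X N))"

definition stratifiable_space :: "'a topology \<Rightarrow> bool" where
  "stratifiable_space X \<longleftrightarrow>
     (\<exists>G :: 'a set \<Rightarrow> nat \<Rightarrow> 'a set.
        (\<forall>U. openin X U \<longrightarrow>
           (\<forall>n. openin X (G U n) \<and> X closure_of (G U n) \<subseteq> U) \<and> (\<Union>n. G U n) = U) \<and>
        (\<forall>U V. openin X U \<and> openin X V \<and> U \<subseteq> V \<longrightarrow> (\<forall>n. G U n \<subseteq> G V n)))"

section \<open>Networks\<close>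

definition k_network :: "'a topology \<Rightarrow> 'a set set \<Rightarrow> bool" where
  "k_network X \<P> \<longleftrightarrow> \<P> \<subseteq> Pow (topspace X) \<and>
     (\<forall>K U. compactin X K \<and> openin X U \<and> K \<subseteq> U \<longrightarrow>
        (\<exists>\<P>'. finite \<P>' \<and> \<P>' \<subseteq> \<P> \<and> K \<subseteq> \<Union>\<P>' \<and> \<Union>\<P>' \<subseteq> U))"

definition point_countable :: "'a topology \<Rightarrow> 'a set set \<Rightarrow> bool" where
  "point_countable X \<P> \<longleftrightarrow> (\<forall>x \<in> topspace X. countable {P \<in> \<P>. x \<in> P})"

definition compact_countable :: "'a topology \<Rightarrow> 'a set set \<Rightarrow> bool" where
  "compact_countable X \<P> \<longleftrightarrow> (\<forall>K. compactin X K \<longrightarrow> countable {P \<in> \<P>. P \<inter> K \<noteq> {}})"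

section \<open>Tanaka's conditions\<close>

definition tanaka_conditions :: "'a topology \<Rightarrow> 'b topology \<Rightarrow> bool" where
  "tanaka_conditions X Y \<longleftrightarrow>
     (first_countable X \<and> first_countable Y) \<or>
     (k_space X \<and> k_space Y \<and> (locally_compact_space X \<or> locally_compact_space Y)) \<or>
     (locally_k_omega_space X \<and> locally_k_omega_space Y)"

end

theory Submission
  imports Defs
begin

text \<open>
  If \<open>X\<close> contains sequences \<open>(x\<^sub>i\<^sub>m)\<^sub>m\<close> converging to a compact set such that every selection of one point from
  each of them is closed and discrete, and \<open>X \<times> Y\<close> is a \<open>k\<^sub>R\<close>-space, then any continuous functions
  \<open>u\<^sub>i : Y \<rightarrow> \<real>\<close> are simultaneously bounded near each point of \<open>Y\<close>. This applies to the fans \<open>S\<^sub>\<omega>\<close> and \<open>S\<^sub>\<omega>\<^sub>1\<close>,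
  and to every stratifiable \<open>k\<close>-space with a point-countable \<open>k\<close>-network that is not first-countable.

  For countably many functions, the boundedness property forces small members of a point-countable \<open>k\<close>-network to be
  relatively compact; an unbounded family of size \<open>\<aleph>\<^sub>1\<close> then shows that every compact set is sequentially
  interior to a \<open>\<sigma>\<close>-compact set, which gives local \<open>\<sigma>\<close>-compactness. For \<open>\<aleph>\<^sub>1\<close> many functions, it excludes
  fans from the space altogether; the space is then first-countable and hence locally compact.
\<close>

section \<open>Stratifiable spaces\<close>

text \<open>The bound on the bounding number enters only through one unbounded family
  \<open>H\<close> of size at most omega_1, which is used in two ways. For local sigma-compactness
  its elements index sequences: any uncountable family of sequences has room for \<open>H\<close>,
  and the value \<open>f n\<close> is prescribed at the \<open>n\<close>-th term of the
  \<open>f\<close>-th sequence, so countably many functions suffice and \<open>S_omega\<close> is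
  strong enough. To exclude fans its elements index functions, each \<open>f\<close> choosing one
  term from every row of the fan; this takes joint boundedness over \<open>H\<close> itself, hence
  \<open>S_omega1\<close>. The rows of a fan converge into a compact set rather than to one point
  because first-countability can fail already through the Frechet property, where the fan obtained
  is of Arens type. Stratifiability acts in two forms: neighbourhoods \<open>nbd n x\<close> through
  which limits pass from nearby points back to the centres, and normality, which extends arbitrary
  functions from closed discrete sets. For the converse in (3), each of Tanaka's conditions makes
  the product a k-space.\<close>

lemma tychonoff_imp_Hausdorff: "tychonoff_space X \<Longrightarrow> Hausdorff_space X"
  by (simp add: completely_regular_imp_regular_space regular_t1_imp_Hausdorff_space tychonoff_space_def)

text \<open>Passing to the unions of the first strata makes the sequence increasing; closure
  commutes with finite unions, so the closures stay inside \<open>U\<close>.\<close>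

lemma stratificationE:
  fixes X :: "'a topology"
  assumes "stratifiable_space X"
  obtains G :: "'a set \<Rightarrow> nat \<Rightarrow> 'a set"
  where "\<And>U n. openin X U \<Longrightarrow> openin X (G U n)"
    and "\<And>U n. openin X U \<Longrightarrow> X closure_of G U n \<subseteq> U"
    and "\<And>U. openin X U \<Longrightarrow> (\<Union>n. G U n) = U"
    and "\<And>U V n. openin X U \<Longrightarrow> openin X V \<Longrightarrow> U \<subseteq> V \<Longrightarrow> G U n \<subseteq> G V n"
    and "\<And>U m n. m \<le> n \<Longrightarrow> G U m \<subseteq> G U n"
proof -
  obtain G :: "'a set \<Rightarrow> nat \<Rightarrow> 'a set" where G:
    "\<And>U n. openin X U \<Longrightarrow> openin X (G U n)"
    "\<And>U n. openin X U \<Longrightarrow> X closure_of (G U n) \<subseteq> U"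
    "\<And>U. openin X U \<Longrightarrow> (\<Union>n. G U n) = U"
    "\<And>U V n. openin X U \<Longrightarrow> openin X V \<Longrightarrow> U \<subseteq> V \<Longrightarrow> G U n \<subseteq> G V n"
    using assms unfolding stratifiable_space_def by metis
  define G' where "G' U n = (\<Union>i\<le>n. G U i)" for U n
  show thesis
  proof (rule that[of G'])
    show "openin X (G' U n)" if "openin X U" for U n
      using that G(1) by (auto simp: G'_def)
    have "X closure_of G' U n = (\<Union>i\<le>n. X closure_of G U i)" for U n
      unfolding G'_def by (subst closure_of_Union) auto
    then show "X closure_of G' U n \<subseteq> U" if "openin X U" for U n
      using G(2)[OF that] by blast
    show "(\<Union>n. G' U n) = U" if "openin X U" for U
      using G(3)[OF that] by (fastforce simp: G'_def)
    show "G' U n \<subseteq> G' V n" if "openin X U" "openin X V" "U \<subseteq> V" for U V n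
      using G(4)[OF that] by (auto simp: G'_def)
    show "G' U m \<subseteq> G' U n" if "m \<le> n" for U and m n :: nat
      using that by (force simp: G'_def)
  qed
qed

lemma stratifiable_imp_normal_space:
  fixes X :: "'a topology"
  assumes "stratifiable_space X"
  shows "normal_space X"
  unfolding normal_space_def
proof (intro allI impI, elim conjE)
  fix S T assume S: "closedin X S" and T: "closedin X T" and ST: "disjnt S T"
  obtain G :: "'a set \<Rightarrow> nat \<Rightarrow> 'a set" where Go: "\<And>U n. openin X U \<Longrightarrow> openin X (G U n)"
    and Gc: "\<And>U n. openin X U \<Longrightarrow> X closure_of G U n \<subseteq> U"
    and Gu: "\<And>U. openin X U \<Longrightarrow> (\<Union>n. G U n) = U"
    and Gm: "\<And>U m n. m \<le> n \<Longrightarrow> G U m \<subseteq> G U n"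
    by (rule stratificationE[OF assms]) (rule that)
  let ?S = "topspace X - S" and ?T = "topspace X - T"
  have o: "openin X ?S" "openin X ?T"
    using S T by auto
  have sub: "S \<subseteq> ?T" "T \<subseteq> ?S"
    using ST S T closedin_subset unfolding disjnt_def by blast+
  define U where "U = (\<Union>n. G ?T n - X closure_of G ?S n)"
  define V where "V = (\<Union>n. G ?S n - X closure_of G ?T n)"
  have "openin X U" "openin X V"
    unfolding U_def V_def using Go o by (auto intro!: openin_diff)
  moreover have "S \<subseteq> U"
  proof
    fix x assume "x \<in> S"
    then obtain n where "x \<in> G ?T n" using Gu[OF o(2)] sub by blast
    moreover have "x \<notin> X closure_of G ?S n" using Gc[OF o(1)] \<open>x \<in> S\<close> by blast
    ultimately show "x \<in> U" unfolding U_def by blast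
  qed
  moreover have "T \<subseteq> V"
  proof
    fix x assume "x \<in> T"
    then obtain n where "x \<in> G ?S n" using Gu[OF o(1)] sub by blast
    moreover have "x \<notin> X closure_of G ?T n" using Gc[OF o(2)] \<open>x \<in> T\<close> by blast
    ultimately show "x \<in> V" unfolding V_def by blast
  qed
  moreover have "disjnt U V"
  proof -
    have cl: "x \<in> X closure_of G W n" if "x \<in> G W n" "openin X W" for x W n
      using that closure_of_subset[OF openin_subset[OF Go]] by blast
    \<comment> \<open>Of the two indices the larger one decides: its stratum contains the stratum of
      smaller index, whose points were removed together with the closure.\<close>
    have False if "x \<in> G ?T n" "x \<notin> X closure_of G ?S n" "x \<in> G ?S m" "x \<notin> X closure_of G ?T m" for x n m
    proof (cases "m \<le> n")
      case True
      then show False using Gm[OF True, of ?S] cl[OF _ o(1)] that by blast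
    next
      case False
      then have "G ?T n \<subseteq> G ?T m" using False by (intro Gm) simp
      then show False using cl[OF _ o(2)] that by blast
    qed
    then show ?thesis unfolding disjnt_def U_def V_def by blast
  qed
  ultimately show "\<exists>U V. openin X U \<and> openin X V \<and> S \<subseteq> U \<and> T \<subseteq> V \<and> disjnt U V"
    by blast
qed

text \<open>This is the g-function form of stratifiability. It replaces open sets by points: one
  \<open>V\<close> serves for all \<open>w\<close> outside \<open>U\<close> and all large
  \<open>n\<close>, so points whose \<open>n\<close>-th neighbourhoods catch a sequence converging
  to \<open>z\<close> must converge to \<open>z\<close> themselves.\<close>

definition stratifying_neighbourhoods :: "'a topology \<Rightarrow> (nat \<Rightarrow> 'a \<Rightarrow> 'a set) \<Rightarrow> bool" where
  "stratifying_neighbourhoods X g \<longleftrightarrow>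
     (\<forall>n. \<forall>x \<in> topspace X. openin X (g n x) \<and> x \<in> g n x) \<and>
     (\<forall>U z. openin X U \<and> z \<in> U \<longrightarrow>
        (\<exists>N V. openin X V \<and> z \<in> V \<and> (\<forall>n\<ge>N. \<forall>w \<in> topspace X - U. g n w \<inter> V = {})))"

text \<open>Take for \<open>g n x\<close> the complement of the closed \<open>n\<close>-th stratum
  of the complement of \<open>x\<close>. A point \<open>w\<close> outside \<open>U\<close> has
  \<open>U\<close> inside its complement, so by monotonicity the stratum \<open>G U N\<close> misses
  \<open>g n w\<close> for every \<open>n \<ge> N\<close>; it is the required
  \<open>V\<close>.\<close>

lemma stratifying_neighbourhoods_exist:
  fixes X :: "'a topology"
  assumes "stratifiable_space X" "t1_space X"
  shows "\<exists>g. stratifying_neighbourhoods X g"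
proof -
  obtain G :: "'a set \<Rightarrow> nat \<Rightarrow> 'a set" where Go: "\<And>U n. openin X U \<Longrightarrow> openin X (G U n)"
    and Gc: "\<And>U n. openin X U \<Longrightarrow> X closure_of G U n \<subseteq> U"
    and Gu: "\<And>U. openin X U \<Longrightarrow> (\<Union>n. G U n) = U"
    and GUV: "\<And>U V n. openin X U \<Longrightarrow> openin X V \<Longrightarrow> U \<subseteq> V \<Longrightarrow> G U n \<subseteq> G V n"
    and Gm: "\<And>U m n. m \<le> n \<Longrightarrow> G U m \<subseteq> G U n"
    by (rule stratificationE[OF assms(1)]) (rule that)
  define g where "g n x = topspace X - X closure_of G (topspace X - {x}) n" for n x
  have o: "openin X (topspace X - {x})" if "x \<in> topspace X" for x
    using assms(2) that by (simp add: closedin_t1_singleton openin_diff)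
  have "stratifying_neighbourhoods X g"
    unfolding stratifying_neighbourhoods_def
  proof (intro conjI allI ballI impI)
    show "openin X (g n x)" for n x
      by (simp add: g_def openin_diff)
    show "x \<in> g n x" if "x \<in> topspace X" for n x
      using Gc[OF o[OF that]] that by (auto simp: g_def)
    fix U z assume "openin X U \<and> z \<in> U"
    then have U: "openin X U" "z \<in> U" by auto
    then obtain N where N: "z \<in> G U N" using Gu by blast
    have "g n w \<inter> G U N = {}" if "n \<ge> N" "w \<in> topspace X - U" for n w
    proof -
      have "G U N \<subseteq> G (topspace X - {w}) n"
        using Gm[OF that(1), of U] GUV[OF U(1) o, of w n] that U openin_subset by blast
      also have "\<dots> \<subseteq> X closure_of G (topspace X - {w}) n"
        using closure_of_subset[OF openin_subset[OF Go[OF o]]] that by blast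
      finally show ?thesis by (auto simp: g_def)
    qed
    then show "\<exists>N V. openin X V \<and> z \<in> V \<and> (\<forall>n\<ge>N. \<forall>w \<in> topspace X - U. g n w \<inter> V = {})"
      using N Go[OF U(1), of N] by (intro exI[of _ N] exI[of _ "G U N"]) simp
  qed
  then show ?thesis by blast
qed

lemma compactin_point_cover:
  assumes "compactin X K" "\<And>z. z \<in> K \<Longrightarrow> openin X (V z)" "\<And>z. z \<in> K \<Longrightarrow> z \<in> V z"
  obtains F where "finite F" "F \<subseteq> K" "K \<subseteq> (\<Union>z\<in>F. V z)"
proof -
  have "\<exists>\<F>. finite \<F> \<and> \<F> \<subseteq> V ` K \<and> K \<subseteq> \<Union>\<F>"
    by (rule compactinD[OF assms(1)]) (use assms in auto)
  then obtain \<F> where \<F>: "finite \<F>" "\<F> \<subseteq> V ` K" "K \<subseteq> \<Union>\<F>" by blast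
  obtain F where "F \<subseteq> K" "finite F" "\<F> = V ` F"
    using finite_subset_image[OF \<F>(1,2)] by auto
  with \<F>(3) show thesis by (intro that[of F]) auto
qed

lemma compact_cluster_point:
  fixes w :: "nat \<Rightarrow> 'a"
  assumes "compactin X K" "\<And>n. w n \<in> K"
  obtains z where "z \<in> K" "\<And>U. openin X U \<Longrightarrow> z \<in> U \<Longrightarrow> infinite {n. w n \<in> U}"
proof -
  have "\<exists>z\<in>K. \<forall>U. openin X U \<and> z \<in> U \<longrightarrow> infinite {n. w n \<in> U}"
  proof (rule ccontr)
    assume "\<not> ?thesis"
    then obtain W where W: "\<And>z. z \<in> K \<Longrightarrow> openin X (W z) \<and> z \<in> W z \<and> finite {n. w n \<in> W z}"
      by metis
    obtain F where F: "finite F" "F \<subseteq> K" "K \<subseteq> (\<Union>z\<in>F. W z)"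
      by (rule compactin_point_cover[OF assms(1), of W]) (use W in auto)
    have "UNIV \<subseteq> (\<Union>z\<in>F. {n. w n \<in> W z})"
      using assms(2) F by blast
    moreover have "finite (\<Union>z\<in>F. {n. w n \<in> W z})"
      using F W by blast
    ultimately show False
      using finite_subset infinite_UNIV_nat by blast
  qed
  then show thesis using that by blast
qed

section \<open>Convergent sequences in stratifiable k-spaces\<close>

locale stratifiable_k_space =
  fixes X :: "'a topology"
  assumes tychonoff: "tychonoff_space X"
    and stratifiable: "stratifiable_space X"
    and k_space: "k_space X"
begin

lemma Hausdorff: "Hausdorff_space X"
  using tychonoff by (rule tychonoff_imp_Hausdorff)

lemma t1: "t1_space X"
  using tychonoff by (simp add: tychonoff_space_def)

lemma regular: "regular_space X"
  using tychonoff by (simp add: tychonoff_space_def completely_regular_imp_regular_space)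

lemma normal: "normal_space X"
  using stratifiable by (rule stratifiable_imp_normal_space)

lemma limit_unique: "limitin X y p sequentially \<Longrightarrow> limitin X y q sequentially \<Longrightarrow> p = q"
  by (rule limitin_Hausdorff_unique[OF _ _ _ Hausdorff]) auto

definition nbd :: "nat \<Rightarrow> 'a \<Rightarrow> 'a set" where
  "nbd = (SOME g. stratifying_neighbourhoods X g)"

lemma stratifying_nbd: "stratifying_neighbourhoods X nbd"
  unfolding nbd_def by (rule someI_ex[OF stratifying_neighbourhoods_exist[OF stratifiable t1]])

lemma openin_nbd: "x \<in> topspace X \<Longrightarrow> openin X (nbd n x)"
  and mem_nbd: "x \<in> topspace X \<Longrightarrow> x \<in> nbd n x"
  using stratifying_nbd unfolding stratifying_neighbourhoods_def by auto

lemma nbd_avoids: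
  assumes "openin X U" "z \<in> U"
  obtains N V where "openin X V" "z \<in> V" "\<And>n w. n \<ge> N \<Longrightarrow> w \<in> topspace X - U \<Longrightarrow> nbd n w \<inter> V = {}"
proof -
  have "\<exists>N V. openin X V \<and> z \<in> V \<and> (\<forall>n\<ge>N. \<forall>w \<in> topspace X - U. nbd n w \<inter> V = {})"
    using stratifying_nbd assms unfolding stratifying_neighbourhoods_def by simp
  then obtain N V where "openin X V" "z \<in> V" "\<forall>n\<ge>N. \<forall>w \<in> topspace X - U. nbd n w \<inter> V = {}"
    by (elim exE conjE)
  then show thesis by (intro that[of V N]) simp_all
qed

text \<open>The sets \<open>nbd n z\<close> need not form a base at \<open>z\<close>, but their
  traces on compact sets behave like one. Avoidance is read backwards: with the complement of
  \<open>z\<close> as the open set, the excluded centre is \<open>z\<close> itself, so every point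
  of \<open>K - U\<close> has a neighbourhood missing \<open>nbd n z\<close> for all large
  \<open>n\<close>, and finitely many of these cover \<open>K - U\<close>.\<close>

lemma nbd_shrinks_in_compact:
  assumes K: "compactin X K" and U: "openin X U" "z \<in> U"
  shows "\<exists>N. \<forall>n\<ge>N. K \<inter> nbd n z \<subseteq> U"
proof -
  have z: "z \<in> topspace X" using U openin_subset by blast
  have KU: "compactin X (K - U)"
  proof -
    have "compactin X ((topspace X - U) \<inter> K)"
      using U K by (intro closed_Int_compactin) auto
    moreover have "(topspace X - U) \<inter> K = K - U"
      using compactin_subset_topspace[OF K] by blast
    ultimately show ?thesis by simp
  qed
  have "openin X (topspace X - {z})"
    using t1 z by (simp add: closedin_t1_singleton openin_diff)
  then have "\<exists>N V. openin X V \<and> x \<in> V \<and> (\<forall>n\<ge>N. nbd n z \<inter> V = {})" if "x \<in> K - U" for x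
  proof -
    have "x \<in> topspace X - {z}"
      using that U compactin_subset_topspace[OF K] by blast
    then obtain N V where
      "openin X V" "x \<in> V" "\<And>n w. n \<ge> N \<Longrightarrow> w \<in> topspace X - (topspace X - {z}) \<Longrightarrow> nbd n w \<inter> V = {}"
      by (rule nbd_avoids[OF \<open>openin X (topspace X - {z})\<close>]) (rule that)
    then show ?thesis using z by (intro exI[of _ N] exI[of _ V]) simp
  qed
  then obtain N V where NV: "\<And>x. x \<in> K - U \<Longrightarrow> openin X (V x) \<and> x \<in> V x \<and> (\<forall>n\<ge>N x. nbd n z \<inter> V x = {})"
    by metis
  obtain F where F: "finite F" "F \<subseteq> K - U" "K - U \<subseteq> (\<Union>x\<in>F. V x)"
    by (rule compactin_point_cover[OF KU, of V]) (use NV in auto)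
  have "K \<inter> nbd n z \<subseteq> U" if "n \<ge> Max (insert 0 (N ` F))" for n
  proof
    fix x assume x: "x \<in> K \<inter> nbd n z"
    show "x \<in> U"
    proof (rule ccontr)
      assume "x \<notin> U"
      then obtain y where y: "y \<in> F" "x \<in> V y" using x F(3) by blast
      then have "n \<ge> N y" using that F(1) by simp
      then show False using NV[of y] y F(2) x by blast
    qed
  qed
  then show "\<exists>N. \<forall>n\<ge>N. K \<inter> nbd n z \<subseteq> U" by blast
qed

text \<open>A centre \<open>w i\<close> outside \<open>U\<close> would keep
  \<open>nbd (k i) (w i)\<close> away from a neighbourhood of \<open>p\<close> that the
  \<open>z i\<close> eventually enter. Whenever a selection from a fan has to be shown divergent, it
  is this transfer to the centres that does it.\<close>

lemma nbd_reflects_limits: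
  assumes z: "limitin X z p sequentially" and k: "filterlim k at_top sequentially"
    and w: "\<And>i::nat. w i \<in> topspace X" "\<And>i. z i \<in> nbd (k i) (w i)"
  shows "limitin X w p sequentially"
  unfolding limitin_def
proof (intro conjI allI impI)
  show "p \<in> topspace X" using z by (rule limitin_topspace)
  fix U assume U: "openin X U \<and> p \<in> U"
  obtain N V where V: "openin X V" "p \<in> V" "\<And>n w. n \<ge> N \<Longrightarrow> w \<in> topspace X - U \<Longrightarrow> nbd n w \<inter> V = {}"
    by (rule nbd_avoids[OF conjunct1[OF U] conjunct2[OF U]]) (rule that)
  have "\<forall>\<^sub>F i in sequentially. z i \<in> V"
    using limitinD[OF z V(1,2)] .
  moreover have "\<forall>\<^sub>F i in sequentially. k i \<ge> N"
    using k by (simp add: filterlim_at_top)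
  ultimately show "\<forall>\<^sub>F i in sequentially. w i \<in> U"
  proof eventually_elim
    case (elim i)
    then show ?case using V(3)[of "k i" "w i"] w by blast
  qed
qed

text \<open>At a cluster point \<open>z\<close> one picks terms in \<open>nbd k z\<close> with
  increasing indices; their convergence is the shrinking of the traces on \<open>K\<close>.\<close>

lemma compact_imp_convergent_subsequence:
  fixes w :: "nat \<Rightarrow> 'a"
  assumes K: "compactin X K" and w: "\<And>n. w n \<in> K"
  obtains r z where "strict_mono r" "z \<in> K" "limitin X (w \<circ> r) z sequentially"
proof -
  obtain z where z: "z \<in> K" "\<And>U. openin X U \<Longrightarrow> z \<in> U \<Longrightarrow> infinite {n. w n \<in> U}"
    by (rule compact_cluster_point[OF K w]) (rule that)
  have zX: "z \<in> topspace X" using z(1) compactin_subset_topspace[OF K] by blast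
  have "\<exists>m>n. w m \<in> nbd k z" for n k
    using z(2)[OF openin_nbd mem_nbd] zX by (simp add: infinite_nat_iff_unbounded)
  then have "\<exists>m. w m \<in> nbd k z \<and> m > n" for n k
    by blast
  then obtain r where r: "\<And>k. w (r k) \<in> nbd k z" "\<And>k. r k < r (Suc k)"
    using dependent_nat_choice[of "\<lambda>k m. w m \<in> nbd k z" "\<lambda>k m m'. m < m'"] by metis
  show thesis
  proof
    show "strict_mono r" using r(2) by (simp add: strict_mono_Suc_iff)
    show "z \<in> K" by fact
    show "limitin X (w \<circ> r) z sequentially"
      unfolding limitin_sequentially
    proof (intro conjI allI impI)
      fix U assume "openin X U \<and> z \<in> U"
      then obtain N where "\<forall>n\<ge>N. K \<inter> nbd n z \<subseteq> U" using nbd_shrinks_in_compact[OF K] by blast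
      then show "\<exists>N. \<forall>n\<ge>N. (w \<circ> r) n \<in> U"
        using r(1) w unfolding comp_def by blast
    qed (rule zX)
  qed
qed

text \<open>The k-space property moves the failure of closedness into a compact set, where the
  traces of \<open>nbd n z\<close> act as a countable base. Thus \<open>X\<close> is sequential, and
  later closedness proofs only have to test sequences.\<close>

lemma not_closedin_imp_sequence:
  assumes "A \<subseteq> topspace X" "\<not> closedin X A"
  obtains y p where "\<And>n. y n \<in> A" "p \<notin> A" "limitin X y p sequentially"
proof -
  obtain K where K: "compactin X K" "\<not> closedin (subtopology X K) (K \<inter> A)"
    using k_space assms unfolding Abstract_Topological_Spaces.k_space by blast
  then have "\<not> closedin X (K \<inter> A)"
    by (meson closedin_subset_topspace inf_le1)
  then obtain z where z: "z \<in> X closure_of (K \<inter> A)" "z \<notin> K \<inter> A"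
    by (metis assms(1) closure_of_subset_eq inf.coboundedI2 subsetI)
  have "closedin X K" using K(1) Hausdorff by (simp add: compactin_imp_closedin)
  then have "z \<in> K" using z(1) closure_of_minimal by (metis inf_le1 subsetD)
  then have "z \<notin> A" using z by blast
  have zX: "z \<in> topspace X" using \<open>z \<in> K\<close> K compactin_subset_topspace by blast
  have "\<exists>y. y \<in> K \<inter> A \<and> y \<in> nbd n z" for n
    using z(1) openin_nbd[OF zX] mem_nbd[OF zX] unfolding in_closure_of by blast
  then obtain y where y: "\<And>n. y n \<in> K \<inter> A \<and> y n \<in> nbd n z"
    by metis
  have "limitin X y z sequentially"
    unfolding limitin_sequentially
  proof (intro conjI allI impI)
    fix U assume "openin X U \<and> z \<in> U"
    then obtain N where "\<forall>n\<ge>N. K \<inter> nbd n z \<subseteq> U" using nbd_shrinks_in_compact[OF K(1)] by blast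
    then show "\<exists>N. \<forall>n\<ge>N. y n \<in> U"
      using y by blast
  qed (rule zX)
  then show thesis using that y \<open>z \<notin> A\<close> by blast
qed

end

section \<open>Joint local boundedness\<close>

lemma strict_mono_subsequence_at_top:
  fixes i :: "nat \<Rightarrow> nat"
  assumes "filterlim i at_top sequentially"
  obtains s :: "nat \<Rightarrow> nat" where "strict_mono s" "strict_mono (i \<circ> s)"
proof -
  have ev: "\<exists>M. \<forall>n\<ge>M. i n > N" for N
    using assms unfolding filterlim_at_top eventually_sequentially by (metis Suc_le_lessD)
  have "\<exists>n'. n' > n \<and> i n' > i n" for n
  proof -
    obtain M where "\<forall>n'\<ge>M. i n' > i n" using ev by blast
    then show ?thesis by (intro exI[of _ "max M (Suc n)"]) auto
  qed
  then have "\<exists>s. \<forall>k. True \<and> (s (Suc k) > s k \<and> i (s (Suc k)) > i (s k))"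
    by (intro dependent_nat_choice[of "\<lambda>_ _. True"]) auto
  then obtain s where "\<And>k. s (Suc k) > s k \<and> i (s (Suc k)) > i (s k)"
    by blast
  then show thesis
    by (intro that[of s]) (simp_all add: strict_mono_Suc_iff)
qed

lemma countable_imp_card_of_ordLeq: "countable A \<Longrightarrow> |A| \<le>o |UNIV :: nat set|"
  unfolding countable_def card_of_ordLeq[symmetric] by auto

text \<open>
  This is what remains of the \<open>k\<^sub>R\<close>-property of the product of \<open>X\<close> with a fan indexed by \<open>I\<close>; all
  further arguments take place in \<open>X\<close> alone.
\<close>

definition jointly_locally_bounded :: "'a topology \<Rightarrow> 'i set \<Rightarrow> bool" where
  "jointly_locally_bounded X I \<longleftrightarrow>
     (\<forall>u :: 'i \<Rightarrow> 'a \<Rightarrow> real. (\<forall>i\<in>I. continuous_map X euclideanreal (u i)) \<longrightarrow>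
        (\<forall>p \<in> topspace X. \<exists>V. openin X V \<and> p \<in> V \<and> (\<forall>i\<in>I. bdd_above (u i ` V))))"

lemma jointly_locally_boundedE:
  assumes "jointly_locally_bounded X I" "p \<in> topspace X"
    and "\<And>i. i \<in> I \<Longrightarrow> continuous_map X euclideanreal (u i)"
  obtains V where "openin X V" "p \<in> V" "\<And>i. i \<in> I \<Longrightarrow> bdd_above (u i ` V)"
proof -
  have "\<forall>i\<in>I. continuous_map X euclideanreal (u i)" using assms(3) by simp
  then have "\<exists>V. openin X V \<and> p \<in> V \<and> (\<forall>i\<in>I. bdd_above (u i ` V))"
    using assms(1)[unfolded jointly_locally_bounded_def, THEN spec[where x = u]] assms(2) by simp
  then show thesis using that by (elim exE conjE) simp
qed

text \<open>Only the cardinality of the index set matters, so members of a network or of an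
  unbounded family can serve as indices directly.\<close>

lemma jointly_locally_bounded_mono:
  fixes I :: "'i set" and J :: "'j set"
  assumes "jointly_locally_bounded X I" "|J| \<le>o |I|"
  shows "jointly_locally_bounded X J"
  unfolding jointly_locally_bounded_def
proof (intro allI impI ballI)
  fix u :: "'j \<Rightarrow> 'a \<Rightarrow> real" and p
  assume u: "\<forall>j\<in>J. continuous_map X euclideanreal (u j)" and p: "p \<in> topspace X"
  obtain e where e: "inj_on e J" "e ` J \<subseteq> I"
    using assms(2) unfolding card_of_ordLeq[symmetric] by blast
  \<comment> \<open>Indices outside the image of \<open>e\<close> receive the zero function, which
    is continuous and imposes nothing.\<close>
  define v where "v i = (if i \<in> e ` J then u (inv_into J e i) else (\<lambda>_. 0))" for i
  have "continuous_map X euclideanreal (v i)" for i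
    using u by (auto simp: v_def inv_into_into)
  then obtain V where V: "openin X V" "p \<in> V" "\<And>i. i \<in> I \<Longrightarrow> bdd_above (v i ` V)"
    by (rule jointly_locally_boundedE[OF assms(1) p, where u = v]) (rule that)
  have "u j = v (e j)" if "j \<in> J" for j
    using e(1) that by (simp add: v_def)
  then show "\<exists>V. openin X V \<and> p \<in> V \<and> (\<forall>j\<in>J. bdd_above (u j ` V))"
    using V e(2) by (intro exI[of _ V]) auto
qed

lemma jointly_locally_bounded_near_compact:
  fixes I :: "'i set"
  assumes X: "jointly_locally_bounded X I" and K: "compactin X K"
    and u: "\<And>i. i \<in> I \<Longrightarrow> continuous_map X euclideanreal (u i)"
  obtains V where "openin X V" "K \<subseteq> V" "\<And>i. i \<in> I \<Longrightarrow> bdd_above (u i ` V)"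
proof -
  have "\<exists>V. openin X V \<and> p \<in> V \<and> (\<forall>i\<in>I. bdd_above (u i ` V))" if "p \<in> K" for p
  proof -
    have "p \<in> topspace X" using that compactin_subset_topspace[OF K] by blast
    then obtain V where "openin X V" "p \<in> V" "\<And>i. i \<in> I \<Longrightarrow> bdd_above (u i ` V)"
      by (rule jointly_locally_boundedE[OF X, where u = u]) (use u in auto)
    then show ?thesis by (intro exI[of _ V]) simp
  qed
  then obtain V where V: "\<And>p. p \<in> K \<Longrightarrow> openin X (V p)" "\<And>p. p \<in> K \<Longrightarrow> p \<in> V p"
      "\<And>p i. p \<in> K \<Longrightarrow> i \<in> I \<Longrightarrow> bdd_above (u i ` V p)"
    by metis
  obtain F where F: "finite F" "F \<subseteq> K" "K \<subseteq> (\<Union>p\<in>F. V p)"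
    by (rule compactin_point_cover[OF K, of V]) (use V in auto)
  show thesis
  proof (rule that[of "\<Union>p\<in>F. V p"])
    show "openin X (\<Union>p\<in>F. V p)" using V(1) F(2) by (intro openin_Union) auto
    show "K \<subseteq> (\<Union>p\<in>F. V p)" by fact
    show "bdd_above (u i ` (\<Union>p\<in>F. V p))" if "i \<in> I" for i
    proof -
      have "bdd_above (\<Union>p\<in>F. u i ` V p)"
        using F V(3) that by (subst bdd_above_UN) auto
      then show ?thesis by (simp add: image_UN)
    qed
  qed
qed

section \<open>Compactness from bounds on continuous functions\<close>

context stratifiable_k_space
begin

text \<open>
  Well-order an open cover, let \<open>m x\<close> be its first member containing \<open>x\<close>, and let \<open>T n\<close> be the set of the
  points \<open>x\<close> that lie in the \<open>n\<close>-th stratum of the union of the cover up to \<open>m x\<close>. By monotonicity of the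
  stratification, near any \<open>z\<close> all points of \<open>T n\<close> have the same \<open>m\<close> as \<open>z\<close>; hence \<open>m\<close> takes only
  finitely many values on \<open>T n\<close>.
\<close>

lemma sequentially_compact_imp_compactin:
  assumes C: "C \<subseteq> topspace X"
    and seq: "\<And>w :: nat \<Rightarrow> 'a. (\<And>n. w n \<in> C) \<Longrightarrow>
                \<exists>r z. strict_mono r \<and> z \<in> C \<and> limitin X (w \<circ> r) z sequentially"
  shows "compactin X C"
  unfolding compactin_def
proof (intro conjI allI impI)
  fix \<U> assume "(\<forall>U\<in>\<U>. openin X U) \<and> C \<subseteq> \<Union>\<U>"
  then have \<U>: "\<forall>U\<in>\<U>. openin X U" "C \<subseteq> \<Union>\<U>" by auto
  obtain r where r: "well_order_on \<U> r"
    using well_order_on by blast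
  then have refl: "(U, U) \<in> r" if "U \<in> \<U>" for U
    using that by (simp add: order_on_defs refl_on_def)
  have antisym: "U = V" if "(U, V) \<in> r" "(V, U) \<in> r" for U V
    using r that by (auto simp: order_on_defs antisym_def)
  have trans: "(U, W) \<in> r" if "(U, V) \<in> r" "(V, W) \<in> r" for U V W
    using r that by (auto simp: order_on_defs dest: transD)
  have total: "(U, V) \<in> r \<or> (V, U) \<in> r" if "U \<in> \<U>" "V \<in> \<U>" for U V
    using r that refl by (cases "U = V") (auto simp: order_on_defs total_on_def)
  have "wf (r - Id)" using r by (simp add: well_order_on_def)
  have "\<exists>M. M \<in> \<U> \<and> x \<in> M \<and> (\<forall>U\<in>\<U>. x \<in> U \<longrightarrow> (M, U) \<in> r)" if "x \<in> C" for x
  proof -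
    let ?Q = "{U \<in> \<U>. x \<in> U}"
    have "\<exists>U0. U0 \<in> ?Q" using \<U>(2) that by blast
    then have "\<exists>M\<in>?Q. \<forall>U. (U, M) \<in> r - Id \<longrightarrow> U \<notin> ?Q"
      using \<open>wf (r - Id)\<close> unfolding wf_eq_minimal by (elim exE) (erule allE[of _ ?Q], blast)
    then obtain M where M: "M \<in> ?Q" "\<And>U. (U, M) \<in> r - Id \<Longrightarrow> U \<notin> ?Q"
      by blast
    have "(M, U) \<in> r" if "U \<in> \<U>" "x \<in> U" for U
    proof (rule ccontr)
      assume n: "(M, U) \<notin> r"
      then have "(U, M) \<in> r" "U \<noteq> M" using total[of U M] refl[of U] that M(1) by auto
      then show False using M(2)[of U] that by blast
    qed
    with M(1) show ?thesis by (intro exI[of _ M]) simp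
  qed
  then obtain m where m: "\<And>x. x \<in> C \<Longrightarrow> m x \<in> \<U>" "\<And>x. x \<in> C \<Longrightarrow> x \<in> m x"
      "\<And>x U. x \<in> C \<Longrightarrow> U \<in> \<U> \<Longrightarrow> x \<in> U \<Longrightarrow> (m x, U) \<in> r"
    by metis
  define V where "V x = \<Union>{U \<in> \<U>. (U, m x) \<in> r}" for x
  define V' where "V' x = \<Union>{U \<in> \<U>. (U, m x) \<in> r \<and> U \<noteq> m x}" for x
  have V_open: "openin X (V x)" "openin X (V' x)" for x
    unfolding V_def V'_def using \<U>(1) by (auto intro: openin_Union)
  obtain G :: "'a set \<Rightarrow> nat \<Rightarrow> 'a set" where G_open: "\<And>U n. openin X U \<Longrightarrow> openin X (G U n)"
    and G_cl: "\<And>U n. openin X U \<Longrightarrow> X closure_of G U n \<subseteq> U"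
    and G_Un: "\<And>U. openin X U \<Longrightarrow> (\<Union>n. G U n) = U"
    and G_mono: "\<And>U V n. openin X U \<Longrightarrow> openin X V \<Longrightarrow> U \<subseteq> V \<Longrightarrow> G U n \<subseteq> G V n"
    by (rule stratificationE[OF stratifiable]) (rule that)
  define T where "T n = {x \<in> C. x \<in> G (V x) n}" for n
  have fin: "finite (m ` T n)" for n
  proof (rule ccontr)
    assume "infinite (m ` T n)"
    then obtain f :: "nat \<Rightarrow> 'a set" where f: "inj f" "range f \<subseteq> m ` T n"
      using infinite_countable_subset by blast
    then have "\<exists>x. x \<in> T n \<and> m x = f k" for k by (metis imageE rangeI subsetD)
    then obtain w where w: "\<And>k. w k \<in> T n" "\<And>k. m (w k) = f k" by metis
    have wC: "w k \<in> C" for k using w(1) by (simp add: T_def)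
    obtain s z where s: "strict_mono s" and z: "z \<in> C" "limitin X (w \<circ> s) z sequentially"
      using seq[of w] wC by blast
    \<comment> \<open>Points of \<open>m z\<close> cannot have a first member later than
      \<open>m z\<close>, and removing the closed stratum of \<open>V' z\<close> excludes the points
      of \<open>T n\<close> whose first member is earlier.\<close>
    define N where "N = m z - X closure_of G (V' z) n"
    have "openin X N" unfolding N_def using m(1) z(1) \<U>(1) by (intro openin_diff) auto
    moreover have "z \<notin> V' z"
      unfolding V'_def using m(3)[OF z(1)] antisym by blast
    then have "z \<in> N" unfolding N_def using m(2)[OF z(1)] G_cl[OF V_open(2)] by blast
    ultimately have "\<forall>\<^sub>F k in sequentially. (w \<circ> s) k \<in> N"
      using limitinD[OF z(2)] by blast
    moreover have "m (w k) = m z" if "w k \<in> N" for k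
    proof (rule ccontr)
      assume ne: "m (w k) \<noteq> m z"
      have "(m (w k), m z) \<in> r"
        using m(3)[OF wC m(1)[OF z(1)]] that by (simp add: N_def)
      then have "V (w k) \<subseteq> V' z"
        unfolding V_def V'_def using trans antisym ne by blast
      then have "G (V (w k)) n \<subseteq> G (V' z) n" using G_mono V_open by blast
      moreover have "w k \<in> G (V (w k)) n" using w(1) by (simp add: T_def)
      moreover have "G (V' z) n \<subseteq> X closure_of G (V' z) n"
        by (rule closure_of_subset[OF openin_subset[OF G_open[OF V_open(2)]]])
      ultimately show False using that unfolding N_def by blast
    qed
    ultimately have "\<forall>\<^sub>F k in sequentially. f (s k) = m z"
      using w(2) by (auto elim!: eventually_mono)
    then obtain k0 where "\<And>k. k \<ge> k0 \<Longrightarrow> f (s k) = m z" by (auto simp: eventually_sequentially)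
    then have "f (s k0) = f (s (Suc k0))" by simp
    then show False using f(1) strict_monoD[OF s, of k0 "Suc k0"] by (simp add: inj_eq)
  qed
  have "C \<subseteq> (\<Union>n. T n)"
  proof
    fix x assume x: "x \<in> C"
    then have "x \<in> V x" unfolding V_def using m refl by blast
    then obtain n where "x \<in> G (V x) n" using G_Un[OF V_open(1)] by blast
    then show "x \<in> (\<Union>n. T n)" using x by (auto simp: T_def)
  qed
  then have "m ` C \<subseteq> (\<Union>n. m ` T n)" by blast
  moreover have "countable (\<Union>n. m ` T n)" using fin by (simp add: countable_finite)
  ultimately have cnt: "countable (m ` C)" using countable_subset by blast
  \<comment> \<open>The sets \<open>m x\<close> now form a countable subcover, which leaves the
    usual argument: a sequence escaping its finite unions would have a limit in some member that it
    eventually avoids.\<close>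
  show "\<exists>\<F>. finite \<F> \<and> \<F> \<subseteq> \<U> \<and> C \<subseteq> \<Union>\<F>"
  proof (cases "C = {}")
    case True
    then show ?thesis by blast
  next
    case False
    define f where "f = from_nat_into (m ` C)"
    have f: "m ` C = range f"
      using range_from_nat_into[OF _ cnt] False by (simp add: f_def)
    show ?thesis
    proof (rule ccontr)
      assume no: "\<not> ?thesis"
      have "\<exists>x. x \<in> C - (\<Union>i\<le>n. f i)" for n
      proof (rule ccontr)
        assume "\<not> ?thesis"
        then have "C \<subseteq> \<Union>(f ` {..n})" by blast
        moreover have "range f \<subseteq> \<U>" using m(1) unfolding f[symmetric] by (rule image_subsetI)
        then have "f ` {..n} \<subseteq> \<U>" by blast
        ultimately show False using no by blast
      qed
      then obtain w where w: "\<And>n. w n \<in> C" "\<And>i n. i \<le> n \<Longrightarrow> w n \<notin> f i"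
        by (metis DiffD1 DiffD2 UN_I atMost_iff)
      obtain s z where s: "strict_mono s" and z: "z \<in> C" "limitin X (w \<circ> s) z sequentially"
        using seq[of w] w(1) by blast
      have "m z \<in> range f" using z(1) unfolding f[symmetric] by (rule imageI)
      then obtain i where i: "m z = f i" by blast
      have "openin X (f i)" "z \<in> f i" using m[OF z(1)] \<U>(1) i by auto
      then have "\<forall>\<^sub>F k in sequentially. w (s k) \<in> f i"
        using limitinD[OF z(2)] by auto
      moreover have "\<forall>\<^sub>F k in sequentially. i \<le> s k"
        using filterlim_subseq[OF s] by (simp add: filterlim_at_top)
      ultimately have "\<forall>\<^sub>F k in sequentially. False"
        by eventually_elim (use w(2) in blast)
      then show False by simp
    qed
  qed
qed (rule C)

text \<open>Such a set is closed and discrete, so any \<open>h\<close> is continuous on it and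
  Tietze's theorem extends it. All functions to which joint local boundedness is applied below
  originate here.\<close>

lemma extend_from_discrete:
  fixes h :: "'a \<Rightarrow> real"
  assumes "S \<subseteq> topspace X" "\<And>T. T \<subseteq> S \<Longrightarrow> closedin X T"
  obtains u where "continuous_map X euclideanreal u" "\<And>x. x \<in> S \<Longrightarrow> u x = h x"
proof -
  have "continuous_map (subtopology X S) euclideanreal h"
  proof -
    have "{x \<in> topspace X. x \<in> S \<and> h x \<in> C} \<subseteq> S" for C by blast
    then show ?thesis
      unfolding continuous_map_closedin
      using assms(2) by (auto intro!: closedin_subset_topspace)
  qed
  then show thesis
    using Tietze_extension_realinterval[OF normal assms(2)[OF order_refl], of UNIV h] that by auto
qed

text \<open>The range of \<open>w\<close> is closed and discrete: if a sequence in a subset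
  \<open>T\<close> converged to a point outside \<open>T\<close>, its indices would tend to
  infinity, since finite subsets of \<open>T\<close> are closed and omit the limit, and
  \<open>w\<close> would have a convergent subsequence.\<close>

lemma divergent_sequence_unbounded_function:
  fixes w :: "nat \<Rightarrow> 'a"
  assumes w: "\<And>n. w n \<in> topspace X"
    and div: "\<And>r z. strict_mono r \<Longrightarrow> \<not> limitin X (w \<circ> r) z sequentially"
  obtains u where "continuous_map X euclideanreal u" "\<And>n. u (w n) \<ge> real n"
proof -
  have fin: "finite {n. w n = x}" if "x \<in> topspace X" for x
  proof (rule ccontr)
    assume "infinite {n. w n = x}"
    then obtain r :: "nat \<Rightarrow> nat" where r: "strict_mono r" "\<And>n. w (r n) = x"
      using infinite_enumerate[of "{n. w n = x}"] by auto
    then have "limitin X (w \<circ> r) x sequentially"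
      using that by (intro limitin_eventually) auto
    then show False using div r by blast
  qed
  have cl: "closedin X T" if T: "T \<subseteq> range w" for T
  proof (rule ccontr)
    assume "\<not> closedin X T"
    moreover have TX: "T \<subseteq> topspace X" using T w by blast
    ultimately obtain y p where y: "\<And>n. y n \<in> T" "p \<notin> T" "limitin X y p sequentially"
      using not_closedin_imp_sequence by metis
    have "\<exists>i. y n = w i" for n using y(1)[of n] T by blast
    then obtain i where i: "\<And>n. y n = w (i n)" by metis
    have "\<forall>\<^sub>F n in sequentially. N \<le> i n" for N
    proof -
      have "closedin X (w ` {..<N} \<inter> T)"
        by (rule t1[unfolded t1_space_closedin_finite, rule_format]) (use TX in auto)
      then have "openin X (topspace X - w ` {..<N} \<inter> T)" by blast
      moreover have "p \<in> topspace X - w ` {..<N} \<inter> T"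
        using y(2) limitin_topspace[OF y(3)] by blast
      ultimately have "\<forall>\<^sub>F n in sequentially. y n \<in> topspace X - w ` {..<N} \<inter> T"
        by (rule limitinD[OF y(3)])
      then show ?thesis
      proof eventually_elim
        case (elim n)
        then have "w (i n) \<notin> w ` {..<N}" using y(1)[of n] i[of n] by auto
        then show ?case by (meson imageI lessThan_iff not_le)
      qed
    qed
    then have "filterlim i at_top sequentially" by (simp add: filterlim_at_top)
    then obtain s :: "nat \<Rightarrow> nat" where s: "strict_mono s" "strict_mono (i \<circ> s)"
      by (rule strict_mono_subsequence_at_top)
    have "y \<circ> s = w \<circ> (i \<circ> s)" using i by auto
    then show False using limitin_subsequence[OF s(1) y(3)] div[OF s(2)] by auto
  qed
  \<comment> \<open>A point may occur several times in \<open>w\<close>, but only finitely often;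
    the largest of its indices serves all occurrences.\<close>
  obtain u where u: "continuous_map X euclideanreal u" "\<And>x. x \<in> range w \<Longrightarrow> u x = real (Max {n. w n = x})"
    using extend_from_discrete[of "range w" "\<lambda>x. real (Max {n. w n = x})"] w cl by auto
  show thesis
  proof (rule that[OF u(1)])
    fix n
    have "n \<le> Max {k. w k = w n}" using fin[OF w] by (intro Max_ge) auto
    then show "real n \<le> u (w n)" using u(2)[of "w n"] by simp
  qed
qed

text \<open>A sequence in the closure without convergent subsequence would carry an unbounded
  continuous function, while a bound on \<open>P\<close> persists on its closure. Used in
  contrapositive form: a set without compact closure has a witness function unbounded on it.\<close>

lemma bounded_imp_compactin_closure_of:
  assumes P: "P \<subseteq> topspace X"
    and bdd: "\<And>u. continuous_map X euclideanreal u \<Longrightarrow> bdd_above (u ` P)"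
  shows "compactin X (X closure_of P)"
proof (rule sequentially_compact_imp_compactin[OF closure_of_subset_topspace])
  fix w :: "nat \<Rightarrow> 'a" assume w: "\<And>n. w n \<in> X closure_of P"
  have wX: "w n \<in> topspace X" for n using w[of n] closure_of_subset_topspace[of X P] by blast
  have "\<exists>r z. strict_mono r \<and> limitin X (w \<circ> r) z sequentially"
  proof (rule ccontr)
    assume no: "\<not> ?thesis"
    obtain u where u: "continuous_map X euclideanreal u" "\<And>n. u (w n) \<ge> real n"
      by (rule divergent_sequence_unbounded_function[OF wX]) (use no in auto)
    obtain b where b: "\<And>x. x \<in> P \<Longrightarrow> u x \<le> b"
      using bdd[OF u(1)] by (auto simp: bdd_above_def)
    have "closedin X {x \<in> topspace X. u x \<in> {..b}}"
      by (rule closedin_continuous_map_preimage[OF u(1)]) simp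
    moreover have "P \<subseteq> {x \<in> topspace X. u x \<in> {..b}}" using P b by auto
    ultimately have "X closure_of P \<subseteq> {x \<in> topspace X. u x \<in> {..b}}"
      by (intro closure_of_minimal)
    then have "u (w n) \<le> b" for n using w[of n] by auto
    then have "real n \<le> b" for n using u(2) order_trans by blast
    then show False using reals_Archimedean2 not_less by metis
  qed
  then obtain r z where r: "strict_mono r" "limitin X (w \<circ> r) z sequentially" by blast
  moreover have "z \<in> X closure_of P"
    by (rule limitin_closedin[OF r(2)]) (use w in auto)
  ultimately show "\<exists>r z. strict_mono r \<and> z \<in> X closure_of P \<and> limitin X (w \<circ> r) z sequentially"
    by blast
qed

text \<open>If no basic neighbourhood of \<open>p\<close> had compact closure, each would carry a
  continuous function unbounded on it. A single neighbourhood bounding these countably many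
  functions contains a basic one, whose own function contradicts this.\<close>

lemma first_countable_jointly_locally_bounded_imp_locally_compact:
  assumes "first_countable X" "jointly_locally_bounded X (UNIV :: nat set)"
  shows "locally_compact_space X"
  unfolding locally_compact_space_def
proof
  fix p assume p: "p \<in> topspace X"
  obtain \<B> where \<B>: "countable \<B>" "\<And>V. V \<in> \<B> \<Longrightarrow> openin X V"
      "\<And>U. openin X U \<Longrightarrow> p \<in> U \<Longrightarrow> \<exists>V\<in>\<B>. p \<in> V \<and> V \<subseteq> U"
    using assms(1) p unfolding first_countable_def by metis
  show "\<exists>U K. openin X U \<and> compactin X K \<and> p \<in> U \<and> U \<subseteq> K"
  proof (rule ccontr)
    assume no: "\<not> ?thesis"
    have "\<exists>u. continuous_map X euclideanreal u \<and> \<not> bdd_above (u ` V)" if "V \<in> \<B>" "p \<in> V" for V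
    proof (rule ccontr)
      assume "\<not> ?thesis"
      then have bdd: "bdd_above (u ` V)" if "continuous_map X euclideanreal u" for u
        using that by simp
      have VX: "V \<subseteq> topspace X" using \<B>(2) that openin_subset by blast
      have "compactin X (X closure_of V)"
        by (rule bounded_imp_compactin_closure_of[OF VX bdd])
      moreover have "V \<subseteq> X closure_of V" by (rule closure_of_subset[OF VX])
      ultimately show False using no \<B>(2)[OF that(1)] that(2) by blast
    qed
    then obtain u where u: "\<And>V. V \<in> \<B> \<Longrightarrow> p \<in> V \<Longrightarrow> continuous_map X euclideanreal (u V)"
        "\<And>V. V \<in> \<B> \<Longrightarrow> p \<in> V \<Longrightarrow> \<not> bdd_above (u V ` V)"
      by metis
    have "|{V \<in> \<B>. p \<in> V}| \<le>o |UNIV :: nat set|"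
      using \<B>(1) by (intro countable_imp_card_of_ordLeq) simp
    then have "jointly_locally_bounded X {V \<in> \<B>. p \<in> V}"
      by (rule jointly_locally_bounded_mono[OF assms(2)])
    then obtain W where W: "openin X W" "p \<in> W" "\<And>V. V \<in> {V \<in> \<B>. p \<in> V} \<Longrightarrow> bdd_above (u V ` W)"
      by (rule jointly_locally_boundedE[OF _ p, where u = u]) (use u(1) in auto)
    obtain V where "V \<in> \<B>" "p \<in> V" "V \<subseteq> W" using \<B>(3)[OF W(1,2)] by blast
    then show False
      using W(3)[of V] u(2)[of V] bdd_above_mono[OF _ image_mono[of V W "u V"]] by simp
  qed
qed

end

section \<open>Networks and local sigma-compactness\<close>

lemma uncountable_imp_omega1_ordLeq:
  assumes "\<not> countable A"
  shows "omega1 \<le>o |A|"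
proof -
  have "\<not> |A| \<le>o natLeq"
  proof
    assume "|A| \<le>o natLeq"
    then have "|A| \<le>o |UNIV :: nat set|"
      using card_of_nat ordIso_symmetric ordLeq_ordIso_trans by blast
    then show False
      using assms unfolding countable_def card_of_ordLeq[symmetric] by auto
  qed
  then have "natLeq <o |A|"
    using not_ordLeq_iff_ordLess[OF natLeq_Well_order card_of_Well_order[of A]] by simp
  then show ?thesis
    by (rule cardSuc_least[OF natLeq_Card_order card_of_Card_order])
qed

text \<open>A tail of \<open>y\<close> together with its limit is compact, so finitely many members
  inside \<open>U\<close> cover it and one of them catches infinitely many terms.\<close>

lemma k_network_frequently:
  assumes \<P>: "k_network X \<P>" and y: "limitin X y x sequentially" and U: "openin X U" "x \<in> U"
  obtains P where "P \<in> \<P>" "P \<subseteq> U" "infinite {n. y n \<in> P}"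
proof -
  obtain N where N: "\<And>n. n \<ge> N \<Longrightarrow> y n \<in> U"
    using y U unfolding limitin_sequentially by blast
  have UX: "U \<subseteq> topspace X" using U(1) by (rule openin_subset)
  let ?T = "range (\<lambda>n. y (n + N))"
  have "compactin X (insert x (topspace X \<inter> ?T))"
    by (rule compactin_sequence_with_limit[OF limitin_sequentially_offset[OF y, of N]]) auto
  moreover have sub: "insert x (topspace X \<inter> ?T) \<subseteq> U" using N U(2) by auto
  ultimately obtain \<P>' where \<P>': "finite \<P>'" "\<P>' \<subseteq> \<P>" "insert x (topspace X \<inter> ?T) \<subseteq> \<Union>\<P>'" "\<Union>\<P>' \<subseteq> U"
    using \<P> U(1) unfolding k_network_def by meson
  have "{N..} \<subseteq> (\<Union>P\<in>\<P>'. {n. y n \<in> P})"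
  proof
    fix n assume "n \<in> {N..}"
    then have "n \<ge> N" by simp
    then have "y n \<in> topspace X" using N UX by blast
    moreover have "y n = y ((n - N) + N)" using \<open>n \<ge> N\<close> by simp
    then have "y n \<in> ?T" by blast
    ultimately have "y n \<in> \<Union>\<P>'" using \<P>'(3) by blast
    then show "n \<in> (\<Union>P\<in>\<P>'. {n. y n \<in> P})" by blast
  qed
  then have "infinite (\<Union>P\<in>\<P>'. {n. y n \<in> P})"
    using infinite_Ici[of N] finite_subset by blast
  then obtain P where "P \<in> \<P>'" "infinite {n. y n \<in> P}"
    using \<P>'(1) by blast
  then show thesis using that[of P] \<P>'(2,4) by blast
qed

text \<open>Known as a wcs*-network. It is the part of the k-network property that survives when
  only the members with compact closure are kept.\<close>

definition sequence_network :: "'a topology \<Rightarrow> 'a set set \<Rightarrow> bool" where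
  "sequence_network X \<P> \<longleftrightarrow>
     (\<forall>y x U. limitin X y x sequentially \<and> openin X U \<and> x \<in> U \<longrightarrow>
        (\<exists>P\<in>\<P>. P \<subseteq> U \<and> infinite {n. y n \<in> P}))"

lemma sequence_networkE:
  assumes "sequence_network X \<P>" "limitin X y x sequentially" "openin X U" "x \<in> U"
  obtains P where "P \<in> \<P>" "P \<subseteq> U" "infinite {n. y n \<in> P}"
  using assms unfolding sequence_network_def by metis

lemma sequence_network_covers:
  assumes "sequence_network X \<P>" "x \<in> topspace X"
  obtains P where "P \<in> \<P>" "x \<in> P"
proof -
  have "limitin X (\<lambda>_::nat. x) x sequentially"
    using assms(2) by (simp add: limitin_eventually)
  then obtain P where "P \<in> \<P>" "infinite {n::nat. x \<in> P}"
    by (rule sequence_networkE[OF assms(1) _ openin_topspace assms(2)])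
  moreover have "x \<in> P" using \<open>infinite {n::nat. x \<in> P}\<close> not_finite_existsD by blast
  ultimately show thesis using that by blast
qed

lemma point_countable_subset: "point_countable X \<P> \<Longrightarrow> \<Q> \<subseteq> \<P> \<Longrightarrow> point_countable X \<Q>"
  unfolding point_countable_def by (auto elim!: countable_subset[rotated])

lemma compact_countable_imp_point_countable:
  assumes "compact_countable X \<P>"
  shows "point_countable X \<P>"
  unfolding point_countable_def
proof
  fix x assume "x \<in> topspace X"
  then have "compactin X {x}" by simp
  then have "countable {P \<in> \<P>. P \<inter> {x} \<noteq> {}}"
    using assms unfolding compact_countable_def by blast
  then show "countable {P \<in> \<P>. x \<in> P}" by simp
qed

section \<open>Relatively compact network members and sigma-compact neighbourhoods\<close>

context stratifiable_k_space
begin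

text \<open>By point-countability only countably many members meet the sequence, so witness
  functions for all those without compact closure are bounded together on some neighbourhood
  \<open>V\<close> of the limit. A member inside \<open>U \<inter> V\<close> that catches infinitely
  many terms then cannot be one of them.\<close>

lemma relatively_compact_sequence_network:
  assumes \<P>: "k_network X \<P>" "point_countable X \<P>"
    and X: "jointly_locally_bounded X (UNIV :: nat set)"
  shows "sequence_network X {P \<in> \<P>. compactin X (X closure_of P)}"
  unfolding sequence_network_def
proof (intro allI impI, elim conjE)
  fix y x U
  assume y: "limitin X y x sequentially" and U: "openin X U" "x \<in> U"
  obtain N where N: "\<And>n. n \<ge> N \<Longrightarrow> y n \<in> U"
    using y U unfolding limitin_sequentially by blast
  have x: "x \<in> topspace X" using y by (rule limitin_topspace)
  have yX: "y n \<in> topspace X" if "n \<ge> N" for n using N[OF that] openin_subset[OF U(1)] by blast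
  \<comment> \<open>Only terms from \<open>N\<close> on are known to lie in the space, where
    point-countability applies.\<close>
  define \<A> where "\<A> = {P \<in> \<P>. (\<exists>n\<ge>N. y n \<in> P) \<and> \<not> compactin X (X closure_of P)}"
  have "countable (\<Union>n\<in>{N..}. {P \<in> \<P>. y n \<in> P})"
    using \<P>(2) yX unfolding point_countable_def by (intro countable_UN) auto
  then have "countable \<A>"
    by (rule countable_subset[rotated]) (auto simp: \<A>_def)
  then have jlb: "jointly_locally_bounded X \<A>"
    by (intro jointly_locally_bounded_mono[OF X] countable_imp_card_of_ordLeq)
  have "\<exists>u. continuous_map X euclideanreal u \<and> \<not> bdd_above (u ` P)" if "P \<in> \<A>" for P
  proof (rule ccontr)
    assume "\<not> ?thesis"
    then have bdd: "bdd_above (u ` P)" if "continuous_map X euclideanreal u" for u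
      using that by simp
    have "P \<subseteq> topspace X" using \<P>(1) that unfolding k_network_def \<A>_def by blast
    then have "compactin X (X closure_of P)"
      by (rule bounded_imp_compactin_closure_of[OF _ bdd])
    then show False using that by (simp add: \<A>_def)
  qed
  then obtain u where u: "\<And>P. P \<in> \<A> \<Longrightarrow> continuous_map X euclideanreal (u P)"
      "\<And>P. P \<in> \<A> \<Longrightarrow> \<not> bdd_above (u P ` P)"
    by metis
  obtain V where V: "openin X V" "x \<in> V" "\<And>P. P \<in> \<A> \<Longrightarrow> bdd_above (u P ` V)"
    by (rule jointly_locally_boundedE[OF jlb x, where u = u, OF u(1)]) (assumption, rule that)
  obtain P where P: "P \<in> \<P>" "P \<subseteq> U \<inter> V" "infinite {n. y n \<in> P}"
    by (rule k_network_frequently[OF \<P>(1) y, of "U \<inter> V"]) (use U V in auto)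
  have "\<exists>n\<ge>N. y n \<in> P" using P(3) by (auto simp: infinite_nat_iff_unbounded_le)
  have "compactin X (X closure_of P)"
  proof (rule ccontr)
    assume "\<not> ?thesis"
    then have "P \<in> \<A>" using P(1) \<open>\<exists>n\<ge>N. y n \<in> P\<close> by (simp add: \<A>_def)
    moreover have "u P ` P \<subseteq> u P ` V" using P(2) by blast
    ultimately show False using u(2)[of P] V(3)[of P] bdd_above_mono[of "u P ` V" "u P ` P"] by simp
  qed
  then show "\<exists>P\<in>{P \<in> \<P>. compactin X (X closure_of P)}. P \<subseteq> U \<and> infinite {n. y n \<in> P}"
    using P by blast
qed

text \<open>
  Take a maximal family of sequences converging into \<open>K\<close> such that no member of \<open>\<R>\<close> meets two of them.
  If it is countable, the closures of the members of \<open>\<R>\<close> meeting it do the job. Otherwise its sequences can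
  be indexed by \<open>f \<in> H\<close>; for each \<open>n\<close> their \<open>n\<close>-th terms form a closed discrete set, on which one may
  prescribe the value \<open>f n\<close>, and joint boundedness near \<open>K\<close> yields a bound for \<open>H\<close>.
\<close>

lemma countable_compact_neighbourhood_family:
  assumes H: "unbounded_family H" "|H| \<le>o omega1"
    and X: "jointly_locally_bounded X (UNIV :: nat set)"
    and \<R>: "sequence_network X \<R>" "point_countable X \<R>" "\<And>R. R \<in> \<R> \<Longrightarrow> compactin X (X closure_of R)"
      "\<R> \<subseteq> Pow (topspace X)"
    and K: "compactin X K"
  obtains \<Q> where "countable \<Q>" "\<And>Q. Q \<in> \<Q> \<Longrightarrow> compactin X Q"
    "\<And>y q. (\<And>n. y n \<in> topspace X) \<Longrightarrow> limitin X y q sequentially \<Longrightarrow> q \<in> K \<Longrightarrow> \<exists>n. y n \<in> \<Union>\<Q>"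
proof -
  define into_K where "into_K y \<longleftrightarrow> (\<forall>n. y n \<in> topspace X) \<and> (\<exists>q\<in>K. limitin X y q sequentially)" for y :: "nat \<Rightarrow> 'a"
  define \<S> where "\<S> = {L. (\<forall>y\<in>L. into_K y) \<and>
     (\<forall>R\<in>\<R>. \<forall>y\<in>L. \<forall>z\<in>L. \<forall>m n. y m \<in> R \<and> z n \<in> R \<longrightarrow> y = z)}"
  have "\<exists>M\<in>\<S>. \<forall>L\<in>\<S>. M \<subseteq> L \<longrightarrow> L = M"
  proof (rule subset_Zorn')
    fix C assume C: "subset.chain \<S> C"
    then have CS: "C \<subseteq> \<S>" and lin: "\<And>L L'. L \<in> C \<Longrightarrow> L' \<in> C \<Longrightarrow> L \<subseteq> L' \<or> L' \<subseteq> L"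
      by (auto simp: subset.chain_def)
    have "into_K y" if "y \<in> \<Union>C" for y
      using that CS by (auto simp: \<S>_def)
    moreover have "y = z" if "R \<in> \<R>" "y \<in> \<Union>C" "z \<in> \<Union>C" "y m \<in> R" "z n \<in> R" for R y z m n
    proof -
      obtain L where L: "L \<in> C" "y \<in> L" "z \<in> L"
        using \<open>y \<in> \<Union>C\<close> \<open>z \<in> \<Union>C\<close> lin by blast
      then have "L \<in> \<S>" using CS by auto
      then show ?thesis using L \<open>R \<in> \<R>\<close> \<open>y m \<in> R\<close> \<open>z n \<in> R\<close> unfolding \<S>_def by blast
    qed
    ultimately show "\<Union>C \<in> \<S>" unfolding \<S>_def by blast
  qed
  then obtain M where M: "M \<in> \<S>" and max: "\<And>L. L \<in> \<S> \<Longrightarrow> M \<subseteq> L \<Longrightarrow> L = M"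
    by blast
  have M_into: "into_K y" if "y \<in> M" for y using M that by (simp add: \<S>_def)
  have M_sep: "y = z" if "R \<in> \<R>" "y \<in> M" "z \<in> M" "y m \<in> R" "z n \<in> R" for R y z m n
    using M that unfolding \<S>_def by blast
  have "countable M"
  proof (rule ccontr)
    assume "\<not> countable M"
    then have "|H| \<le>o |M|"
      using H(2) uncountable_imp_omega1_ordLeq ordLeq_transitive by blast
    then obtain e where e: "inj_on e H" "e ` H \<subseteq> M"
      unfolding card_of_ordLeq[symmetric] by blast
    have eX: "e f n \<in> topspace X" if "f \<in> H" for f n
      using M_into[of "e f"] e(2) that by (auto simp: into_K_def)
    have e_eq: "f = f'" if "f \<in> H" "f' \<in> H" "R \<in> \<R>" "e f m \<in> R" "e f' n \<in> R" for f f' R m n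
      using M_sep[of R "e f" "e f'" m n] that e by (auto dest: inj_onD)
    have inj: "inj_on (\<lambda>f. e f n) H" for n
    proof (rule inj_onI)
      fix f f' assume f: "f \<in> H" "f' \<in> H" "e f n = e f' n"
      obtain R where "R \<in> \<R>" "e f n \<in> R"
        by (rule sequence_network_covers[OF \<R>(1) eX[OF f(1)]])
      then show "f = f'" using e_eq[of f f' R n n] f by simp
    qed
    \<comment> \<open>A member of \<open>\<R>\<close> catching infinitely many terms of a convergent
      sequence in \<open>T\<close> meets only one sequence of the family, so these terms coincide
      and the limit is already in \<open>T\<close>.\<close>
    have cl: "closedin X T" if T: "T \<subseteq> (\<lambda>f. e f n) ` H" for T n
    proof (rule ccontr)
      assume "\<not> closedin X T"
      moreover have TX: "T \<subseteq> topspace X" using T eX by blast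
      ultimately obtain y p where y: "\<And>k. y k \<in> T" "p \<notin> T" "limitin X y p sequentially"
        using not_closedin_imp_sequence by metis
      obtain R where R: "R \<in> \<R>" "infinite {k. y k \<in> R}"
        by (rule sequence_networkE[OF \<R>(1) y(3) openin_topspace limitin_topspace[OF y(3)]])
      obtain r :: "nat \<Rightarrow> nat" where r: "strict_mono r" "\<And>k. y (r k) \<in> R"
        using infinite_enumerate[OF R(2)] by auto
      have "y (r k) = y (r 0)" for k
      proof -
        have "y (r k) \<in> (\<lambda>f. e f n) ` H" "y (r 0) \<in> (\<lambda>f. e f n) ` H"
          using y(1) T by blast+
        then obtain f f' where f: "f \<in> H" "y (r k) = e f n" "f' \<in> H" "y (r 0) = e f' n"
          by blast
        then have "f = f'" using e_eq[of f f' R n n] R(1) r(2)[of k] r(2)[of 0] by simp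
        then show ?thesis using f by simp
      qed
      then have "y \<circ> r = (\<lambda>_. y (r 0))" by auto
      then have "limitin X (\<lambda>_::nat. y (r 0)) p sequentially"
        using limitin_subsequence[OF r(1) y(3)] by simp
      moreover have "limitin X (\<lambda>_::nat. y (r 0)) (y (r 0)) sequentially"
        using TX y(1) by (intro limitin_eventually) auto
      ultimately have "p = y (r 0)" by (rule limit_unique)
      then show False using y(1,2) by simp
    qed
    have "\<exists>u. continuous_map X euclideanreal u \<and> (\<forall>f\<in>H. u (e f n) = real (f n))" for n
    proof -
      let ?h = "\<lambda>x. real (inv_into H (\<lambda>f. e f n) x n)"
      obtain u where u: "continuous_map X euclideanreal u" "\<And>x. x \<in> (\<lambda>f. e f n) ` H \<Longrightarrow> u x = ?h x"
        by (rule extend_from_discrete[of "(\<lambda>f. e f n) ` H" ?h]) (use eX cl in auto)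
      have "u (e f n) = real (f n)" if "f \<in> H" for f
        using u(2)[of "e f n"] inv_into_f_f[OF inj that] that by simp
      then show ?thesis using u(1) by blast
    qed
    then obtain u where u: "\<And>n. continuous_map X euclideanreal (u n)"
        "\<And>n f. f \<in> H \<Longrightarrow> u n (e f n) = real (f n)"
      by metis
    obtain V where V: "openin X V" "K \<subseteq> V" "\<And>n. n \<in> (UNIV :: nat set) \<Longrightarrow> bdd_above (u n ` V)"
      by (rule jointly_locally_bounded_near_compact[OF X K u(1)]) (rule that)
    have "\<exists>b. \<forall>x\<in>V. u n x \<le> real b" for n
    proof -
      obtain c where "\<And>x. x \<in> V \<Longrightarrow> u n x \<le> c" using V(3)[of n] by (auto simp: bdd_above_def)
      moreover obtain b where "c \<le> real b" using real_arch_simple by blast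
      ultimately show ?thesis by (meson order_trans)
    qed
    then obtain b where b: "\<And>n x. x \<in> V \<Longrightarrow> u n x \<le> real (b n)" by metis
    have "\<forall>\<^sub>\<infinity>n. f n \<le> b n" if f: "f \<in> H" for f
    proof -
      obtain q where "q \<in> K" "limitin X (e f) q sequentially"
        using M_into[of "e f"] e(2) f by (auto simp: into_K_def)
      then have "\<forall>\<^sub>F n in sequentially. e f n \<in> V"
        using limitinD[OF _ V(1)] V(2) by blast
      then have "\<forall>\<^sub>F n in sequentially. f n \<le> b n"
      proof eventually_elim
        case (elim n)
        then show ?case using b[of "e f n" n] u(2)[OF f, of n] by simp
      qed
      then show ?thesis by (simp add: cofinite_eq_sequentially)
    qed
    then show False using H(1) unfolding unbounded_family_def by blast
  qed
  define \<Q> where "\<Q> = (closure_of) X ` (\<Union>y\<in>M. \<Union>n. {R \<in> \<R>. y n \<in> R})"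
  show thesis
  proof
    have "countable {R \<in> \<R>. y n \<in> R}" if "y \<in> M" for y n
      using \<R>(2) M_into[OF that] unfolding point_countable_def into_K_def by blast
    then show "countable \<Q>"
      unfolding \<Q>_def using \<open>countable M\<close> by (intro countable_image countable_UN) auto
    show "compactin X Q" if "Q \<in> \<Q>" for Q
      using that \<R>(3) by (auto simp: \<Q>_def)
    fix y q assume y: "\<And>n. y n \<in> topspace X" "limitin X y q sequentially" "q \<in> K"
    show "\<exists>n. y n \<in> \<Union>\<Q>"
    \<comment> \<open>A sequence \<open>y\<close> missing \<open>\<Union>\<Q>\<close> shares no
      member of \<open>\<R>\<close> with \<open>M\<close>, so by maximality it belongs to
      \<open>M\<close>. The closure of a member containing \<open>y 0\<close> is then in
      \<open>\<Q>\<close>, which is absurd.\<close>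
    proof (rule ccontr)
      assume no: "\<not> ?thesis"
      have disj: "y m \<notin> R" if "z \<in> M" "R \<in> \<R>" "z n \<in> R" for z R m n
      proof
        assume "y m \<in> R"
        moreover have "R \<subseteq> X closure_of R" using \<R>(4) that(2) by (intro closure_of_subset) auto
        moreover have "X closure_of R \<in> \<Q>" using that by (auto simp: \<Q>_def)
        ultimately show False using no by blast
      qed
      have "into_K y" using y by (auto simp: into_K_def)
      then have "insert y M \<in> \<S>"
        using M_into M_sep disj unfolding \<S>_def by (auto; blast)
      then have "y \<in> M" using max[of "insert y M"] by blast
      moreover obtain R where "R \<in> \<R>" "y 0 \<in> R"
        by (rule sequence_network_covers[OF \<R>(1) y(1)])
      ultimately show False using disj[of y R 0 0] by blast
    qed
  qed
qed

text \<open>Start with \<open>{p}\<close> and repeatedly replace each compact set by its countable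
  family \<open>Q K\<close>. A sequence converging to a point of the union of all stages has its
  limit in some \<open>K\<close> of stage \<open>n\<close> and hence a term in stage
  \<open>n + 1\<close>; so no sequence in the complement converges into the union, and the
  complement is closed because \<open>X\<close> is sequential.\<close>

lemma open_sigma_compact_neighbourhood:
  assumes H: "unbounded_family H" "|H| \<le>o omega1"
    and X: "jointly_locally_bounded X (UNIV :: nat set)"
    and \<P>: "k_network X \<P>" "point_countable X \<P>"
    and p: "p \<in> topspace X"
  obtains \<K> where "countable \<K>" "\<And>K. K \<in> \<K> \<Longrightarrow> compactin X K" "openin X (\<Union>\<K>)" "p \<in> \<Union>\<K>"
proof -
  let ?R = "{P \<in> \<P>. compactin X (X closure_of P)}"
  have R: "sequence_network X ?R"
    by (rule relatively_compact_sequence_network[OF \<P> X])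
  have R': "point_countable X ?R"
    by (rule point_countable_subset[OF \<P>(2)]) blast
  have R'': "?R \<subseteq> Pow (topspace X)" using \<P>(1) unfolding k_network_def by blast
  have "\<exists>\<Q>. countable \<Q> \<and> (\<forall>Q\<in>\<Q>. compactin X Q) \<and>
      (\<forall>y q. (\<forall>n. y n \<in> topspace X) \<and> limitin X y q sequentially \<and> q \<in> K \<longrightarrow> (\<exists>n::nat. y n \<in> \<Union>\<Q>))"
    if K: "compactin X K" for K
  proof -
    obtain \<Q> where "countable \<Q>" "\<And>Q. Q \<in> \<Q> \<Longrightarrow> compactin X Q"
      "\<And>y q. (\<And>n. y n \<in> topspace X) \<Longrightarrow> limitin X y q sequentially \<Longrightarrow> q \<in> K \<Longrightarrow> \<exists>n::nat. y n \<in> \<Union>\<Q>"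
      by (rule countable_compact_neighbourhood_family[OF H X R R' _ R'' K]) auto
    then show ?thesis by (intro exI[of _ \<Q>]) auto
  qed
  then obtain Q where Q: "\<And>K. compactin X K \<Longrightarrow> countable (Q K)"
      "\<And>K L. compactin X K \<Longrightarrow> L \<in> Q K \<Longrightarrow> compactin X L"
      "\<And>K y q. compactin X K \<Longrightarrow> (\<And>n. y n \<in> topspace X) \<Longrightarrow> limitin X y q sequentially \<Longrightarrow> q \<in> K
         \<Longrightarrow> \<exists>n::nat. y n \<in> \<Union>(Q K)"
    by metis
  define \<K> where "\<K> n = ((\<lambda>\<C>. \<Union>(Q ` \<C>)) ^^ n) {{p}}" for n :: nat
  have \<K>: "countable (\<K> n) \<and> (\<forall>K\<in>\<K> n. compactin X K)" for n
  proof (induction n)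
    case 0
    show ?case using p by (simp add: \<K>_def)
  next
    case (Suc n)
    then show ?case using Q(1,2) by (auto simp: \<K>_def)
  qed
  show thesis
  proof (rule that[of "\<Union>n. \<K> n"])
    show "countable (\<Union>n. \<K> n)" using \<K> by blast
    show cpt: "compactin X K" if "K \<in> (\<Union>n. \<K> n)" for K using \<K> that by blast
    have "{p} \<in> \<K> 0" by (simp add: \<K>_def)
    then show "p \<in> \<Union>(\<Union>n. \<K> n)" by blast
    have sub: "\<Union>(\<Union>n. \<K> n) \<subseteq> topspace X" using cpt compactin_subset_topspace by blast
    have "closedin X (topspace X - \<Union>(\<Union>n. \<K> n))"
    proof (rule ccontr)
      assume "\<not> ?thesis"
      then obtain y q where y: "\<And>n. y n \<in> topspace X - \<Union>(\<Union>n. \<K> n)"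
          "q \<notin> topspace X - \<Union>(\<Union>n. \<K> n)" "limitin X y q sequentially"
        by (rule not_closedin_imp_sequence[OF Diff_subset]) (rule that)
      then obtain n K where K: "K \<in> \<K> n" "q \<in> K" using limitin_topspace[OF y(3)] by blast
      have yX: "y k \<in> topspace X" for k using y(1)[of k] by simp
      have "compactin X K" using \<K>[of n] K(1) by simp
      from Q(3)[OF this yX y(3) K(2)] obtain k where "y k \<in> \<Union>(Q K)" by (elim exE)
      moreover have "Q K \<subseteq> \<K> (Suc n)" using K(1) by (auto simp: \<K>_def)
      ultimately have "y k \<in> \<Union>(\<Union>n. \<K> n)" by blast
      then show False using y(1) by blast
    qed
    then show "openin X (\<Union>(\<Union>n. \<K> n))"
      using sub by (simp add: openin_closedin_eq)
  qed
qed

lemma jointly_locally_bounded_imp_locally_sigma_compact: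
  assumes "unbounded_family H" "|H| \<le>o omega1"
    and "jointly_locally_bounded X (UNIV :: nat set)"
    and "k_network X \<P>" "point_countable X \<P>"
  shows "locally_sigma_compact_space X"
  unfolding locally_sigma_compact_space_def
proof
  fix p assume "p \<in> topspace X"
  then obtain \<K> where \<K>: "countable \<K>" "\<And>K. K \<in> \<K> \<Longrightarrow> compactin X K" "openin X (\<Union>\<K>)" "p \<in> \<Union>\<K>"
    by (rule open_sigma_compact_neighbourhood[OF assms]) (rule that)
  then have "range (from_nat_into \<K>) = \<K>"
    by (intro range_from_nat_into) auto
  then have "sigma_compact_space (subtopology X (\<Union>\<K>))"
    unfolding sigma_compact_space_def
  proof (intro exI[of _ "from_nat_into \<K>"] conjI allI)
    fix n
    have "from_nat_into \<K> n \<in> \<K>" using \<open>range (from_nat_into \<K>) = \<K>\<close> by blast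
    then show "compactin (subtopology X (\<Union>\<K>)) (from_nat_into \<K> n)"
      using \<K>(2) by (auto simp: compactin_subtopology)
  next
    show "topspace (subtopology X (\<Union>\<K>)) = (\<Union>n. from_nat_into \<K> n)"
      using openin_subset[OF \<K>(3)] \<open>range (from_nat_into \<K>) = \<K>\<close> by (simp add: inf_absorb2)
  qed
  then show "\<exists>U N. openin X U \<and> p \<in> U \<and> U \<subseteq> N \<and> N \<subseteq> topspace X \<and> sigma_compact_space (subtopology X N)"
    using \<K>(3,4) openin_subset by blast
qed

text \<open>Every nonempty network member inside a sigma-compact open \<open>E\<close> meets one of
  countably many compact sets, so compact-countability leaves only countably many. The compact
  closures of those that stay in \<open>E\<close> determine the topology of \<open>E\<close>, since
  every sequence converging in \<open>E\<close> is frequently in one of them.\<close>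

lemma jointly_locally_bounded_imp_locally_k_omega:
  assumes H: "unbounded_family H" "|H| \<le>o omega1"
    and X: "jointly_locally_bounded X (UNIV :: nat set)"
    and \<P>: "k_network X \<P>" "compact_countable X \<P>"
  shows "locally_k_omega_space X"
  unfolding locally_k_omega_space_def
proof
  fix p assume p: "p \<in> topspace X"
  note \<P>_pc = compact_countable_imp_point_countable[OF \<P>(2)]
  obtain \<K> where \<K>: "countable \<K>" "\<And>K. K \<in> \<K> \<Longrightarrow> compactin X K" "openin X (\<Union>\<K>)" "p \<in> \<Union>\<K>"
    by (rule open_sigma_compact_neighbourhood[OF H X \<P>(1) \<P>_pc p]) (rule that)
  define E where "E = \<Union>\<K>"
  have E: "openin X E" "p \<in> E" "E \<subseteq> topspace X" using \<K>(3,4) openin_subset by (auto simp: E_def)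
  \<comment> \<open>The empty set is added so that \<open>from_nat_into\<close> enumerates a
    nonempty family.\<close>
  define \<Q> where "\<Q> = insert {} {P \<in> \<P>. compactin X (X closure_of P) \<and> X closure_of P \<subseteq> E}"
  have "\<Q> \<subseteq> insert {} (\<Union>K\<in>\<K>. {P \<in> \<P>. P \<inter> K \<noteq> {}})"
  proof
    fix P assume P: "P \<in> \<Q>"
    show "P \<in> insert {} (\<Union>K\<in>\<K>. {P \<in> \<P>. P \<inter> K \<noteq> {}})"
    proof (cases "P = {}")
      case False
      then have "P \<in> \<P>" "X closure_of P \<subseteq> E" using P by (auto simp: \<Q>_def)
      moreover have "P \<subseteq> X closure_of P"
        using \<P>(1) \<open>P \<in> \<P>\<close> unfolding k_network_def by (intro closure_of_subset) auto
      ultimately show ?thesis using False unfolding E_def by blast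
    qed simp
  qed
  moreover have "countable (insert {} (\<Union>K\<in>\<K>. {P \<in> \<P>. P \<inter> K \<noteq> {}}))"
    using \<K>(1,2) \<P>(2) unfolding compact_countable_def by auto
  ultimately have "countable \<Q>" using countable_subset by blast
  then have rng: "range (from_nat_into \<Q>) = \<Q>"
    by (intro range_from_nat_into) (auto simp: \<Q>_def)
  define C where "C n = X closure_of from_nat_into \<Q> n" for n
  have C: "compactin X (C n)" "C n \<subseteq> E" for n
  proof -
    have "from_nat_into \<Q> n \<in> \<Q>" using rng by blast
    then show "compactin X (C n)" "C n \<subseteq> E" by (auto simp: \<Q>_def C_def)
  qed
  have "k_omega_space (subtopology X E)"
    unfolding k_omega_space_def
  proof (intro exI[of _ C] conjI allI impI)
    show "compactin (subtopology X E) (C n)" for n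
      using C by (simp add: compactin_subtopology)
    fix F assume "F \<subseteq> topspace (subtopology X E) \<and>
      (\<forall>n. closedin (subtopology (subtopology X E) (C n)) (F \<inter> C n))"
    then have F: "F \<subseteq> E" "\<And>n. closedin (subtopology X (C n)) (F \<inter> C n)"
      using C(2) by (auto simp: subtopology_subtopology inf_absorb2)
    have F_cl: "closedin X (F \<inter> C n)" for n
      using F(2) by (rule closedin_trans_full) (simp add: C_def)
    \<comment> \<open>Adding the complement of \<open>E\<close> turns relative closedness into
      closedness in \<open>X\<close>, where the sequential criterion is available.\<close>
    have "closedin X (F \<union> (topspace X - E))"
    proof (rule ccontr)
      assume "\<not> ?thesis"
      moreover have "F \<union> (topspace X - E) \<subseteq> topspace X" using F(1) E(3) by blast
      ultimately obtain y q where y: "\<And>n. y n \<in> F \<union> (topspace X - E)" "q \<notin> F \<union> (topspace X - E)"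
          "limitin X y q sequentially"
        using not_closedin_imp_sequence by metis
      have q: "q \<in> E" "q \<notin> F" using y(2) limitin_topspace[OF y(3)] by auto
      \<comment> \<open>The closure of \<open>W\<close> must lie in \<open>E\<close>, so that a
        network member found inside \<open>W\<close> belongs to \<open>\<Q>\<close>.\<close>
      obtain W where W: "openin X W" "q \<in> W" "X closure_of W \<subseteq> E"
      proof -
        have "neighbourhood_base_of (closedin X) X"
          using regular by (simp add: neighbourhood_base_of_closedin)
        then obtain W C' where "openin X W" "closedin X C'" "q \<in> W" "W \<subseteq> C'" "C' \<subseteq> E"
          using E(1) q(1) unfolding neighbourhood_base_of by meson
        moreover from this have "X closure_of W \<subseteq> C'" by (intro closure_of_minimal)
        ultimately show thesis by (intro that[of W]) auto
      qed
      have seqnet: "sequence_network X {P \<in> \<P>. compactin X (X closure_of P)}"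
        by (rule relatively_compact_sequence_network[OF \<P>(1) \<P>_pc X])
      obtain P where P: "P \<in> {P \<in> \<P>. compactin X (X closure_of P)}" "P \<subseteq> W" "infinite {n. y n \<in> P}"
        by (rule sequence_networkE[OF seqnet y(3) W(1,2)])
      have "X closure_of P \<subseteq> E" using closure_of_mono[OF P(2), of X] W(3) by blast
      then have "P \<in> \<Q>" using P(1) by (simp add: \<Q>_def)
      then obtain n where n: "C n = X closure_of P" using rng unfolding C_def by (metis rangeE)
      have "P \<subseteq> C n"
        unfolding n using P(1) \<P>(1) unfolding k_network_def by (intro closure_of_subset) auto
      obtain r :: "nat \<Rightarrow> nat" where r: "strict_mono r" "\<And>k. y (r k) \<in> P"
        using infinite_enumerate[OF P(3)] by auto
      have "(y \<circ> r) k \<in> F \<inter> C n" for k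
        using y(1)[of "r k"] r(2)[of k] \<open>P \<subseteq> C n\<close> C(2) by auto
      then have "q \<in> F \<inter> C n"
        by (intro limitin_closedin[OF limitin_subsequence[OF r(1) y(3)] F_cl]) auto
      then show False using q by blast
    qed
    moreover have "F = E \<inter> (F \<union> (topspace X - E))" using F(1) by blast
    ultimately show "closedin (subtopology X E) F"
      unfolding closedin_subtopology by (metis inf_commute)
  qed
  then show "\<exists>U N. openin X U \<and> p \<in> U \<and> U \<subseteq> N \<and> N \<subseteq> topspace X \<and> k_omega_space (subtopology X N)"
    using E by blast
qed

end

section \<open>Fans\<close>

text \<open>
  Sequences \<open>x i\<close> converging to the compact set \<open>K\<close>, with bump functions \<open>\<psi> i m\<close> at the points \<open>x i m\<close> that
  vanish on \<open>K\<close> and are compact-finite below the graph of any function of \<open>i\<close>.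
\<close>

definition bump_fan :: "'a topology \<Rightarrow> 'i set \<Rightarrow> 'a set \<Rightarrow> ('i \<Rightarrow> nat \<Rightarrow> 'a) \<Rightarrow> ('i \<Rightarrow> nat \<Rightarrow> 'a \<Rightarrow> real) \<Rightarrow> bool" where
  "bump_fan X I K x \<psi> \<longleftrightarrow>
     compactin X K \<and>
     (\<forall>i\<in>I. \<forall>U. openin X U \<and> K \<subseteq> U \<longrightarrow> (\<forall>\<^sub>F m in sequentially. x i m \<in> U)) \<and>
     (\<forall>i\<in>I. \<forall>m. continuous_map X euclideanreal (\<psi> i m) \<and> \<psi> i m (x i m) = 1 \<and>
        (\<forall>z\<in>topspace X. 0 \<le> \<psi> i m z) \<and> (\<forall>z\<in>K. \<psi> i m z = 0)) \<and>
     (\<forall>C c. compactin X C \<longrightarrow> finite {(i, m). i \<in> I \<and> m \<le> c i \<and> (\<exists>z\<in>C. \<psi> i m z \<noteq> 0)})"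

lemma compactin_continuous_real_bounded:
  assumes "compactin X C" "continuous_map X euclideanreal u"
  obtains c :: nat where "\<And>x. x \<in> C \<Longrightarrow> u x \<le> real c"
proof -
  have "compact (u ` C)"
    using image_compactin[OF assms] by simp
  then have "bdd_above (u ` C)"
    by (intro bounded_imp_bdd_above compact_imp_bounded)
  then obtain b where "\<And>x. x \<in> C \<Longrightarrow> u x \<le> b" by (auto simp: bdd_above_def)
  moreover obtain c where "b \<le> real c" using real_arch_simple by blast
  ultimately show thesis using that[of c] by (meson order_trans)
qed

text \<open>
  The function \<open>F (z, y) = (\<Sum>i m. \<psi> i m z * min 1 (max 0 (u i y - m)))\<close> reduces to a finite sum on each
  compact set, so it is continuous, and it vanishes on \<open>K \<times> Y\<close>; the condition \<open>F < 1\<close> near \<open>K \<times> {p}\<close> bounds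
  every \<open>u i\<close> near \<open>p\<close>.
\<close>

lemma bump_fan_kR_prod_imp_jointly_locally_bounded:
  fixes X :: "'a topology" and Y :: "'b topology" and I :: "'i set"
  assumes fan: "bump_fan X I K x \<psi>" and kR: "kR_space (prod_topology X Y)"
  shows "jointly_locally_bounded Y I"
  unfolding jointly_locally_bounded_def
proof (intro allI impI ballI)
  fix u :: "'i \<Rightarrow> 'b \<Rightarrow> real" and p
  assume "\<forall>i\<in>I. continuous_map Y euclideanreal (u i)" and p: "p \<in> topspace Y"
  then have u: "\<And>i. i \<in> I \<Longrightarrow> continuous_map Y euclideanreal (u i)" by blast
  have K: "compactin X K" using fan by (simp add: bump_fan_def)
  have x: "\<exists>m. x i m \<in> U" if "i \<in> I" "openin X U" "K \<subseteq> U" for i U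
  proof -
    have "\<forall>\<^sub>F m in sequentially. x i m \<in> U" using fan that unfolding bump_fan_def by blast
    then show ?thesis using eventually_happens' sequentially_bot by blast
  qed
  have \<psi>: "continuous_map X euclideanreal (\<psi> i m)" "\<psi> i m (x i m) = 1" if "i \<in> I" for i m
    using fan that unfolding bump_fan_def by auto
  have \<psi>_nonneg: "0 \<le> \<psi> i m z" if "i \<in> I" "z \<in> topspace X" for i m z
    using fan that unfolding bump_fan_def by auto
  have \<psi>_K: "\<psi> i m z = 0" if "i \<in> I" "z \<in> K" for i m z
    using fan that unfolding bump_fan_def by auto
  have \<psi>_fin: "finite {(i, m). i \<in> I \<and> m \<le> c i \<and> (\<exists>z\<in>C. \<psi> i m z \<noteq> 0)}" if "compactin X C" for C c
    using fan that unfolding bump_fan_def by auto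
  define \<theta> where "\<theta> m t = min 1 (max 0 (t - real m))" for m t
  define T where "T v = (\<lambda>(i, m). \<psi> i m (fst v) * \<theta> m (u i (snd v)))" for v
  \<comment> \<open>A \<open>sum\<close> over an infinite set would silently be 0;
    \<open>S_sub\<close> and \<open>\<psi>_fin\<close>, applied to a single point, exclude this on
    the product.\<close>
  define S where "S v = {(i, m). i \<in> I \<and> \<psi> i m (fst v) * \<theta> m (u i (snd v)) \<noteq> 0}" for v
  define F where "F v = sum (T v) (S v)" for v
  have S_sub: "S v \<subseteq> {(i, m). i \<in> I \<and> m \<le> c i \<and> (\<exists>z\<in>C. \<psi> i m z \<noteq> 0)}"
    if "fst v \<in> C" "\<And>i. i \<in> I \<Longrightarrow> u i (snd v) \<le> real (c i)" for v C c
  proof -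
    have "m \<le> c i" if "i \<in> I" "\<theta> m (u i (snd v)) \<noteq> 0" for i m
    proof -
      have "u i (snd v) > real m" using that(2) by (auto simp: \<theta>_def min_def max_def split: if_splits)
      then show ?thesis using \<open>\<And>i. i \<in> I \<Longrightarrow> u i (snd v) \<le> real (c i)\<close>[OF that(1)] by linarith
    qed
    then show ?thesis using \<open>fst v \<in> C\<close> by (auto simp: S_def)
  qed
  have "continuous_map (subtopology (prod_topology X Y) D) euclideanreal F"
    if D: "compactin (prod_topology X Y) D" for D
  proof -
    have C: "compactin X (fst ` D)" by (rule image_compactin[OF D continuous_map_fst])
    have E: "compactin Y (snd ` D)" by (rule image_compactin[OF D continuous_map_snd])
    have "\<exists>c::nat. \<forall>y\<in>snd ` D. u i y \<le> real c" if "i \<in> I" for i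
      by (rule compactin_continuous_real_bounded[OF E u[OF that]]) blast
    then obtain c :: "'i \<Rightarrow> nat" where c: "\<And>i y. i \<in> I \<Longrightarrow> y \<in> snd ` D \<Longrightarrow> u i y \<le> real (c i)"
      by metis
    define R where "R = {(i, m). i \<in> I \<and> m \<le> c i \<and> (\<exists>z\<in>fst ` D. \<psi> i m z \<noteq> 0)}"
    have R_fin: "finite R" unfolding R_def by (rule \<psi>_fin[OF C])
    \<comment> \<open>On \<open>D\<close> the functions \<open>u i\<close> are bounded by
      \<open>c i\<close>, so all supports lie in the one finite set \<open>R\<close> given by
      compact-finiteness.\<close>
    have "sum (T v) R = F v" if "v \<in> D" for v
      unfolding F_def
    proof (rule sum.mono_neutral_right[OF R_fin])
      show "S v \<subseteq> R" unfolding R_def by (rule S_sub) (use that c in auto)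
      show "\<forall>j\<in>R - S v. T v j = 0" by (auto simp: R_def S_def T_def)
    qed
    moreover have "continuous_map (prod_topology X Y) euclideanreal (\<lambda>v. sum (T v) R)"
    proof (rule continuous_map_sum[OF R_fin])
      fix j assume "j \<in> R"
      then obtain i m where j: "j = (i, m)" "i \<in> I" by (auto simp: R_def)
      have 1: "continuous_map (prod_topology X Y) euclideanreal (\<lambda>v. \<psi> i m (fst v))"
        using continuous_map_compose[OF continuous_map_fst \<psi>(1)[OF j(2)]] by (simp add: comp_def)
      have 2: "continuous_map (prod_topology X Y) euclideanreal (\<lambda>v. u i (snd v))"
        using continuous_map_compose[OF continuous_map_snd u[OF j(2)]] by (simp add: comp_def)
      show "continuous_map (prod_topology X Y) euclideanreal (\<lambda>v. T v j)"
        unfolding T_def j \<theta>_def prod.case by (intro continuous_intros 1 2) simp_all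
    qed
    ultimately show ?thesis
      by (intro continuous_map_eq[OF continuous_map_from_subtopology[where f = "\<lambda>v. sum (T v) R"]]) auto
  qed
  then have F_cont: "continuous_map (prod_topology X Y) euclideanreal F"
    using kR unfolding kR_space_def by blast
  have W: "openin (prod_topology X Y) {v \<in> topspace (prod_topology X Y). F v \<in> {..<1}}"
    by (rule openin_continuous_map_preimage[OF F_cont]) simp
  have "F (z, p) = 0" if "z \<in> K" for z
    unfolding F_def by (rule sum.neutral) (use \<psi>_K that in \<open>auto simp: T_def S_def\<close>)
  then have KW: "K \<times> {p} \<subseteq> {v \<in> topspace (prod_topology X Y). F v \<in> {..<1}}"
    using compactin_subset_topspace[OF K] p by auto
  have "compactin Y {p}" using p by simp
  then obtain U V where UV: "openin X U" "openin Y V" "K \<subseteq> U" "{p} \<subseteq> V"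
      "U \<times> V \<subseteq> {v \<in> topspace (prod_topology X Y). F v \<in> {..<1}}"
    by (rule Wallace_theorem_prod_topology[OF K _ W KW])
  have "bdd_above (u i ` V)" if i: "i \<in> I" for i
  proof -
    \<comment> \<open>Since \<open>\<psi> i m\<close> is 1 at \<open>x i m\<close>, the single term
      with index \<open>(i, m)\<close> equals \<open>\<theta> m (u i y)\<close> there; all terms are
      nonnegative, so \<open>F < 1\<close> forces \<open>u i y \<le> m + 1\<close>.\<close>
    obtain m where m: "x i m \<in> U" using x[OF i UV(1,3)] by blast
    have "u i y \<le> real m + 1" if y: "y \<in> V" for y
    proof -
      have v: "x i m \<in> topspace X" "F (x i m, y) < 1" using UV(5) m y by auto
      have "finite (S (x i m, y))"
      proof (rule finite_subset[OF S_sub \<psi>_fin])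
        show "fst (x i m, y) \<in> {x i m}" by simp
        show "compactin X {x i m}" using v(1) by simp
        show "u j (snd (x i m, y)) \<le> real (nat \<lceil>u j y\<rceil>)" for j
          by (simp add: of_nat_nat real_nat_ceiling_ge)
      qed
      moreover have "0 \<le> T (x i m, y) j" if "j \<in> S (x i m, y)" for j
        using that \<psi>_nonneg v(1) by (auto simp: T_def S_def \<theta>_def)
      ultimately have "\<theta> m (u i y) \<le> F (x i m, y)"
      proof (cases "(i, m) \<in> S (x i m, y)")
        case True
        then have "T (x i m, y) (i, m) \<le> F (x i m, y)"
          unfolding F_def using \<open>finite (S (x i m, y))\<close> \<open>\<And>j. j \<in> S (x i m, y) \<Longrightarrow> 0 \<le> T (x i m, y) j\<close>
          by (intro member_le_sum) auto
        then show ?thesis by (simp add: T_def \<psi>(2)[OF i])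
      next
        case False
        then have "\<theta> m (u i y) = 0" using i by (simp add: S_def \<psi>(2)[OF i])
        moreover have "0 \<le> F (x i m, y)"
          unfolding F_def using \<open>\<And>j. j \<in> S (x i m, y) \<Longrightarrow> 0 \<le> T (x i m, y) j\<close> by (rule sum_nonneg)
        ultimately show ?thesis by simp
      qed
      then have "\<theta> m (u i y) < 1" using v(2) by simp
      then show ?thesis by (auto simp: \<theta>_def min_def max_def split: if_splits)
    qed
    then show ?thesis by (auto simp: bdd_above_def)
  qed
  then show "\<exists>V. openin Y V \<and> p \<in> V \<and> (\<forall>i\<in>I. bdd_above (u i ` V))"
    using UV(2,4) by (intro exI[of _ V]) simp
qed

section \<open>Sequential fans as bump fans\<close>

lemma openin_convergent_sequence:
  "openin convergent_sequence U \<longleftrightarrow> (None \<in> U \<longrightarrow> finite {n. Some n \<notin> U})"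
proof (cases "None \<in> U")
  case False
  then have "t \<in> U \<longleftrightarrow> t \<in> Some ` {n. Some n \<in> U}" for t by (cases t) auto
  then have "U = Some ` {n. Some n \<in> U}" by blast
  then show ?thesis
    using False unfolding convergent_sequence_def openin_Alexandroff_compactification by auto
next
  case True
  have "U = insert None (Some ` (UNIV - C)) \<longleftrightarrow> {n. Some n \<notin> U} = C" for C
  proof
    assume "U = insert None (Some ` (UNIV - C))"
    then show "{n. Some n \<notin> U} = C" by auto
  next
    assume "{n. Some n \<notin> U} = C"
    then have "t \<in> U \<longleftrightarrow> t \<in> insert None (Some ` (UNIV - C))" for t
      using True by (cases t) auto
    then show "U = insert None (Some ` (UNIV - C))" by blast
  qed
  then show ?thesis
    using True unfolding convergent_sequence_def openin_Alexandroff_compactification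
    by (auto simp: compactin_discrete_topology)
qed

lemma topspace_convergent_sequence: "topspace convergent_sequence = UNIV"
  unfolding convergent_sequence_def by (auto simp: notin_range_Some)

text \<open>Nonemptiness of \<open>I\<close> is what puts the vertex \<open>None\<close> into the
  space: the quotient of the empty sum is empty.\<close>

lemma openin_sequential_fan:
  assumes "I \<noteq> {}"
  shows "openin (sequential_fan I) U \<longleftrightarrow>
    U \<subseteq> insert None (Some ` (I \<times> UNIV)) \<and> (None \<in> U \<longrightarrow> (\<forall>i\<in>I. finite {n. Some (i, n) \<notin> U}))"
proof -
  have img: "fan_map ` topspace (sum_topology (\<lambda>i. convergent_sequence) I) = insert None (Some ` (I \<times> UNIV))"
  proof (rule set_eqI)
    fix t :: "('a \<times> nat) option"
    obtain i0 where "i0 \<in> I" using assms by blast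
    show "t \<in> fan_map ` topspace (sum_topology (\<lambda>i. convergent_sequence) I) \<longleftrightarrow>
          t \<in> insert None (Some ` (I \<times> UNIV))"
    proof (cases t)
      case None
      have "fan_map (i0, None) = None" by simp
      then show ?thesis using None \<open>i0 \<in> I\<close>
        by (auto simp: topspace_convergent_sequence intro!: image_eqI[of _ _ "(i0, None)"])
    next
      case (Some jn)
      obtain j n where jn: "jn = (j, n)" by (cases jn)
      have "fan_map s = Some (j, n) \<longleftrightarrow> s = (j, Some n)" for s :: "'a \<times> nat option"
        by (cases s; cases "snd s") auto
      then have "t \<in> fan_map ` Z \<longleftrightarrow> (j, Some n) \<in> Z" for Z :: "('a \<times> nat option) set"
        unfolding Some jn image_iff by metis
      then show ?thesis by (auto simp: topspace_convergent_sequence Some jn)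
    qed
  qed
  have "openin (sum_topology (\<lambda>i. convergent_sequence) I)
      {x \<in> topspace (sum_topology (\<lambda>i. convergent_sequence) I). fan_map x \<in> U} \<longleftrightarrow>
    (None \<in> U \<longrightarrow> (\<forall>i\<in>I. finite {n. Some (i, n) \<notin> U}))"
    unfolding openin_sum_topology openin_convergent_sequence
    by (auto simp: topspace_convergent_sequence)
  then show ?thesis
    unfolding sequential_fan_def openin_quotient_topology img by simp
qed

text \<open>All points but the vertex are isolated, so indicators are continuous bumps. A compact
  set meets only finitely many spines off the vertex: one chosen point from each forms a closed
  discrete set, whose complement and singletons give an open cover.\<close>

lemma bump_fan_sequential_fan:
  fixes I :: "'i set"
  assumes "I \<noteq> {}"
  shows "bump_fan (sequential_fan I) I {None} (\<lambda>i m. Some (i, m)) (\<lambda>i m. indicator {Some (i, m)})"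
proof -
  let ?S = "sequential_fan I"
  note o = openin_sequential_fan[OF assms]
  have top: "topspace ?S = insert None (Some ` (I \<times> UNIV))"
  proof -
    have "openin ?S (insert None (Some ` (I \<times> UNIV)))" using o by (auto simp: image_iff)
    moreover have "topspace ?S \<subseteq> insert None (Some ` (I \<times> UNIV))"
      using o[of "topspace ?S"] by simp
    ultimately show ?thesis using openin_subset by blast
  qed
  have K: "compactin ?S {None}" by (simp add: top)
  have lim: "\<forall>\<^sub>F m in sequentially. Some (i, m) \<in> U" if "i \<in> I" "openin ?S U" "{None} \<subseteq> U" for i U
  proof -
    have "finite {m. Some (i, m) \<notin> U}" using that o by blast
    then show ?thesis by (simp add: cofinite_eq_sequentially[symmetric] eventually_cofinite)
  qed
  have cont: "continuous_map ?S euclideanreal (indicator {Some (i, m)})" if i: "i \<in> I" for i m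
  proof -
    have 1: "openin ?S {Some (i, m)}" using i o by auto
    have "{n. Some (j, n) \<notin> topspace ?S - {Some (i, m)}} \<subseteq> {m}" if "j \<in> I" for j
      using that by (auto simp: top)
    then have 2: "openin ?S (topspace ?S - {Some (i, m)})"
      unfolding o using finite_subset by (auto simp: top)
    have "openin ?S {x \<in> topspace ?S. indicator {Some (i, m)} x \<in> V}" for V :: "real set"
    proof -
      have "{x \<in> topspace ?S. indicator {Some (i, m)} x \<in> V} =
        (if 1 \<in> V then {Some (i, m)} else {}) \<union> (if 0 \<in> V then topspace ?S - {Some (i, m)} else {})"
        using openin_subset[OF 1] by (auto simp: indicator_def split: if_splits)
      moreover have "openin ?S (if 1 \<in> V then {Some (i, m)} else {})"
        "openin ?S (if 0 \<in> V then topspace ?S - {Some (i, m)} else {})"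
        using 1 2 by simp_all
      ultimately show ?thesis by (simp only: openin_Un)
    qed
    then show ?thesis by (simp add: continuous_map)
  qed
  have fin: "finite {(i, m). i \<in> I \<and> m \<le> c i \<and> (\<exists>z\<in>C. indicator {Some (i, m)} z \<noteq> (0::real))}"
    if C: "compactin ?S C" for C and c :: "'i \<Rightarrow> nat"
  proof -
    define J where "J = {i \<in> I. \<exists>m. Some (i, m) \<in> C}"
    then have "\<exists>m. Some (i, m) \<in> C" if "i \<in> J" for i using that by simp
    then obtain m where m: "\<And>i. i \<in> J \<Longrightarrow> Some (i, m i) \<in> C" by metis
    define U0 where "U0 = topspace ?S - (\<lambda>i. Some (i, m i)) ` J"
    have "finite {n. Some (i, n) \<notin> U0}" if "i \<in> I" for i
      by (rule finite_subset[of _ "{m i}"]) (use that in \<open>auto simp: U0_def top\<close>)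
    moreover have "U0 \<subseteq> insert None (Some ` (I \<times> UNIV))" by (auto simp: U0_def top)
    ultimately have oU0: "openin ?S U0" unfolding o by blast
    have oS: "openin ?S {Some (i, m i)}" if "i \<in> J" for i
      using that unfolding o J_def by auto
    have "C \<subseteq> \<Union>(insert U0 ((\<lambda>i. {Some (i, m i)}) ` J))"
      using compactin_subset_topspace[OF C] by (auto simp: U0_def)
    then have "\<exists>\<F>. finite \<F> \<and> \<F> \<subseteq> insert U0 ((\<lambda>i. {Some (i, m i)}) ` J) \<and> C \<subseteq> \<Union>\<F>"
      by (rule compactinD[OF C, rotated]) (use oU0 oS in auto)
    then obtain \<F> where \<F>: "finite \<F>" "\<F> \<subseteq> insert U0 ((\<lambda>i. {Some (i, m i)}) ` J)" "C \<subseteq> \<Union>\<F>"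
      by blast
    have "(\<lambda>i. {Some (i, m i)}) ` J \<subseteq> \<F>"
    proof
      fix A assume "A \<in> (\<lambda>i. {Some (i, m i)}) ` J"
      then obtain i where i: "i \<in> J" "A = {Some (i, m i)}" by blast
      then obtain B where B: "B \<in> \<F>" "Some (i, m i) \<in> B" using m \<F>(3) by blast
      then have "B \<noteq> U0" using i by (auto simp: U0_def)
      then obtain j where "B = {Some (j, m j)}" using B(1) \<F>(2) by blast
      then show "A \<in> \<F>" using B i by simp
    qed
    then have "finite ((\<lambda>i. {Some (i, m i)}) ` J)" using \<F>(1) finite_subset by blast
    moreover have "inj_on (\<lambda>i. {Some (i, m i)}) J" by (auto simp: inj_on_def)
    ultimately have "finite J" by (rule finite_imageD)
    then have "finite (SIGMA i:J. {..c i})" by auto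
    then show ?thesis
      by (rule finite_subset[rotated]) (auto simp: J_def indicator_def split: if_splits)
  qed
  show ?thesis
    unfolding bump_fan_def using K lim cont fin by (auto simp: indicator_def)
qed

text \<open>
  Closed copies of \<open>S\<^sub>\<omega>\<close> (with \<open>K\<close> a point) and of the Arens space \<open>S\<^sub>2\<close> (with \<open>K\<close> a convergent sequence)
  are instances.
\<close>

definition sequence_fan :: "'a topology \<Rightarrow> 'a set \<Rightarrow> (nat \<Rightarrow> nat \<Rightarrow> 'a) \<Rightarrow> bool" where
  "sequence_fan X K y \<longleftrightarrow>
     compactin X K \<and> (\<forall>n m. y n m \<in> topspace X) \<and> (\<forall>n. \<exists>q\<in>K. limitin X (y n) q sequentially) \<and>
     (\<forall>f r z. strict_mono r \<longrightarrow> \<not> limitin X (\<lambda>k. y (r k) (f k)) z sequentially)"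

lemma sequence_fanD:
  "sequence_fan X K y \<Longrightarrow> strict_mono r \<Longrightarrow> \<not> limitin X (\<lambda>k. y (r k) (f k)) z sequentially"
  unfolding sequence_fan_def by blast

section \<open>Sequence fans, the Frechet property and first-countability\<close>

context stratifiable_k_space
begin

text \<open>Each \<open>f\<close> selects a divergent sequence \<open>y n (f n)\<close>, on which
  some continuous \<open>u f\<close> grows at least like \<open>n\<close>. If one neighbourhood
  \<open>V\<close> of \<open>K\<close> bounded all \<open>u f\<close>, and \<open>g n\<close> marks
  where row \<open>n\<close> has entered \<open>V\<close> for good, then
  \<open>f n \<ge> g n\<close> could hold only for finitely many \<open>n\<close>; so
  \<open>g\<close> would dominate \<open>H\<close>.\<close>

lemma sequence_fan_imp_not_jointly_locally_bounded:
  assumes y: "sequence_fan X K y" and H: "unbounded_family H"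
  shows "\<not> jointly_locally_bounded X H"
proof
  assume jlb: "jointly_locally_bounded X H"
  have "\<exists>u. continuous_map X euclideanreal u \<and> (\<forall>n. u (y n (f n)) \<ge> real n)" for f
  proof -
    have "y n (f n) \<in> topspace X" for n using y by (simp add: sequence_fan_def)
    moreover have "\<not> limitin X ((\<lambda>n. y n (f n)) \<circ> r) z sequentially" if "strict_mono r" for r z
      using sequence_fanD[OF y that, of "f \<circ> r" z] by (simp add: comp_def)
    ultimately obtain u where "continuous_map X euclideanreal u" "\<And>n. u (y n (f n)) \<ge> real n"
      by (rule divergent_sequence_unbounded_function[where w = "\<lambda>n. y n (f n)"]) (assumption, rule that)
    then show ?thesis by blast
  qed
  then obtain u where u: "\<And>f. continuous_map X euclideanreal (u f)" "\<And>f n. u f (y n (f n)) \<ge> real n"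
    by metis
  have K: "compactin X K" using y by (simp add: sequence_fan_def)
  obtain V where V: "openin X V" "K \<subseteq> V" "\<And>f. f \<in> H \<Longrightarrow> bdd_above (u f ` V)"
    by (rule jointly_locally_bounded_near_compact[OF jlb K, where u = u, OF u(1)]) (rule that)
  have "\<exists>N. \<forall>m\<ge>N. y n m \<in> V" for n
  proof -
    obtain q where "q \<in> K" "limitin X (y n) q sequentially" using y unfolding sequence_fan_def by blast
    then show ?thesis using V(1,2) unfolding limitin_sequentially by blast
  qed
  then obtain g where g: "\<And>n m. m \<ge> g n \<Longrightarrow> y n m \<in> V" by metis
  have "\<forall>\<^sub>\<infinity>n. f n \<le> g n" if f: "f \<in> H" for f
  proof -
    obtain b where "\<And>x. x \<in> V \<Longrightarrow> u f x \<le> b" using V(3)[OF f] by (auto simp: bdd_above_def)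
    then have b: "real n \<le> b" if "f n \<ge> g n" for n using g[OF that] u(2)[of n f] by fastforce
    obtain N :: nat where "b < real N" using reals_Archimedean2 by blast
    then have "f n \<le> g n" if "n \<ge> N" for n using b[of n] that by (meson nle_le not_less of_nat_mono order_trans)
    then have "\<forall>\<^sub>F n in sequentially. f n \<le> g n" by (auto simp: eventually_sequentially)
    then show ?thesis by (simp add: cofinite_eq_sequentially)
  qed
  then show False using H unfolding unbounded_family_def by blast
qed

text \<open>Bumps that vanish on \<open>K\<close> need centres outside \<open>K\<close>. Only
  finitely many rows meet \<open>K\<close> infinitely often, since otherwise a selection inside the
  compact set \<open>K\<close> would have a convergent subsequence; drop these rows and an initial
  part of each other row.\<close>

lemma sequence_fan_avoiding:
  assumes y: "sequence_fan X K y"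
  obtains y' where "sequence_fan X K y'" "\<And>n m. y' n m \<notin> K"
proof -
  have K: "compactin X K" using y by (simp add: sequence_fan_def)
  define B where "B = {n. infinite {m. y n m \<in> K}}"
  have "finite B"
  proof (rule ccontr)
    assume "infinite B"
    then obtain r :: "nat \<Rightarrow> nat" where r: "strict_mono r" "\<And>k. r k \<in> B"
      using infinite_enumerate by blast
    have "\<exists>m. y (r k) m \<in> K" for k
      using r(2)[of k] not_finite_existsD unfolding B_def by blast
    then obtain f where f: "\<And>k. y (r k) (f k) \<in> K" by metis
    obtain s z where s: "strict_mono s" "z \<in> K" "limitin X ((\<lambda>k. y (r k) (f k)) \<circ> s) z sequentially"
      by (rule compact_imp_convergent_subsequence[OF K, of "\<lambda>k. y (r k) (f k)"]) (use f in auto)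
    have "strict_mono (r \<circ> s)" using r(1) s(1) by (rule strict_mono_o)
    moreover have "limitin X (\<lambda>k. y ((r \<circ> s) k) ((f \<circ> s) k)) z sequentially"
      using s(3) by (simp add: comp_def)
    ultimately show False using y unfolding sequence_fan_def by blast
  qed
  then obtain N where N: "\<And>n. n \<ge> N \<Longrightarrow> n \<notin> B"
    by (metis finite_nat_set_iff_bounded not_less)
  have "\<exists>t. \<forall>m\<ge>t. y (N + n) m \<notin> K" for n
  proof -
    have "finite {m. y (N + n) m \<in> K}" using N[of "N + n"] by (simp add: B_def)
    then obtain t where "\<forall>m\<in>{m. y (N + n) m \<in> K}. m < t" unfolding finite_nat_set_iff_bounded by blast
    then show ?thesis by (intro exI[of _ t]) (auto simp: not_less[symmetric])
  qed
  then obtain t where t: "\<And>n m. m \<ge> t n \<Longrightarrow> y (N + n) m \<notin> K" by metis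
  define y' where "y' n m = y (N + n) (m + t n)" for n m
  show thesis
  proof
    show "y' n m \<notin> K" for n m by (simp add: y'_def t)
    have "\<exists>q\<in>K. limitin X (y' n) q sequentially" for n
    proof -
      obtain q where q: "q \<in> K" "limitin X (y (N + n)) q sequentially"
        using y unfolding sequence_fan_def by blast
      have "y' n = (\<lambda>i. y (N + n) (i + t n))" by (auto simp: y'_def)
      then show ?thesis using limitin_sequentially_offset[OF q(2), of "t n"] q(1) by auto
    qed
    moreover have "\<not> limitin X (\<lambda>k. y' (r k) (f k)) z sequentially" if "strict_mono r" for f r z
    proof -
      have "strict_mono (\<lambda>k. N + r k)" using that by (simp add: strict_mono_def)
      then have "\<not> limitin X (\<lambda>k. y (N + r k) (f k + t (r k))) z sequentially"
        by (rule sequence_fanD[OF y, of _ "\<lambda>k. f k + t (r k)"])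
      then show ?thesis by (simp add: y'_def)
    qed
    ultimately show "sequence_fan X K y'"
      using y unfolding sequence_fan_def by (auto simp: y'_def)
  qed
qed

text \<open>The bump at \<open>x n m\<close> is supported in \<open>nbd (n + m) (x n m)\<close>,
  whose index tends to infinity with \<open>n\<close>. If a compact set met supports from infinitely
  many rows, a convergent sequence of meeting points would carry its limit over to the centres,
  giving a convergent selection from the fan.\<close>

lemma sequence_fan_imp_bump_fan:
  assumes "sequence_fan X K y"
  obtains x \<psi> where "bump_fan X (UNIV :: nat set) K x \<psi>"
proof -
  obtain x where x: "sequence_fan X K x" and xK: "\<And>n m. x n m \<notin> K"
    by (rule sequence_fan_avoiding[OF assms]) (rule that)
  have K: "compactin X K" and xX: "\<And>n m. x n m \<in> topspace X"
    using x by (auto simp: sequence_fan_def)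
  have "\<exists>\<phi>. continuous_map X euclideanreal \<phi> \<and> \<phi> (x n m) = 1 \<and> (\<forall>z\<in>topspace X. 0 \<le> \<phi> z) \<and>
      (\<forall>z\<in>topspace X. \<phi> z \<noteq> 0 \<longrightarrow> z \<in> nbd (n + m) (x n m) - K)" for n m
  proof -
    let ?O = "nbd (n + m) (x n m) - K"
    have "closedin X K" using K Hausdorff by (simp add: compactin_imp_closedin)
    then have "closedin X (topspace X - ?O)" using openin_nbd[OF xX] by (intro closedin_diff openin_diff) auto
    moreover have "x n m \<in> topspace X - (topspace X - ?O)" using mem_nbd[OF xX] xK xX by simp
    ultimately obtain f :: "'a \<Rightarrow> real" where f: "continuous_map X (top_of_set {0..1}) f"
        "f (x n m) = 0" "f ` (topspace X - ?O) \<subseteq> {1}"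
      using tychonoff unfolding tychonoff_space_def completely_regular_space_def by meson
    have "continuous_map X euclideanreal f" "\<And>z. z \<in> topspace X \<Longrightarrow> f z \<in> {0..1}"
      using f(1) unfolding continuous_map_in_subtopology by auto
    then show ?thesis
      using f(2,3) by (intro exI[of _ "\<lambda>z. 1 - f z"]) (auto intro!: continuous_intros)
  qed
  then obtain \<psi> where \<psi>: "\<And>n m. continuous_map X euclideanreal (\<psi> n m)" "\<And>n m. \<psi> n m (x n m) = 1"
      "\<And>n m z. z \<in> topspace X \<Longrightarrow> 0 \<le> \<psi> n m z"
      "\<And>n m z. z \<in> topspace X \<Longrightarrow> \<psi> n m z \<noteq> 0 \<Longrightarrow> z \<in> nbd (n + m) (x n m) - K"
    by metis
  have fin: "finite {(n, m). m \<le> c n \<and> (\<exists>z\<in>C. \<psi> n m z \<noteq> 0)}" if C: "compactin X C" for C c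
  proof -
    define J where "J = {n. \<exists>m\<le>c n. \<exists>z\<in>C. \<psi> n m z \<noteq> 0}"
    have "finite J"
    proof (rule ccontr)
      assume "infinite J"
      then obtain r :: "nat \<Rightarrow> nat" where r: "strict_mono r" "\<And>k. r k \<in> J"
        using infinite_enumerate by blast
      have "\<exists>m. \<exists>z\<in>C. \<psi> (r k) m z \<noteq> 0" for k using r(2)[of k] by (auto simp: J_def)
      then obtain m z where mz: "\<And>k. z k \<in> C" "\<And>k. \<psi> (r k) (m k) (z k) \<noteq> 0" by metis
      obtain s p where s: "strict_mono s" "p \<in> C" "limitin X (z \<circ> s) p sequentially"
        by (rule compact_imp_convergent_subsequence[OF C, of z]) (use mz in auto)
      have "(z \<circ> s) k \<in> nbd (r (s k) + m (s k)) (x (r (s k)) (m (s k)))" for k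
        using \<psi>(4)[OF _ mz(2)[of "s k"]] mz(1)[of "s k"] compactin_subset_topspace[OF C] by auto
      moreover have "filterlim (\<lambda>k. r (s k) + m (s k)) at_top sequentially"
      proof -
        have "filterlim (r \<circ> s) at_top sequentially"
          by (rule filterlim_subseq) (intro strict_mono_o r s)
        then show ?thesis by (rule filterlim_at_top_mono) simp
      qed
      ultimately have "limitin X (\<lambda>k. x (r (s k)) (m (s k))) p sequentially"
        using nbd_reflects_limits[OF s(3), of "\<lambda>k. r (s k) + m (s k)" "\<lambda>k. x (r (s k)) (m (s k))"] xX by blast
      moreover have "strict_mono (\<lambda>k. r (s k))" using strict_mono_o[OF r(1) s(1)] by (simp add: comp_def)
      ultimately show False
        using sequence_fanD[OF x, of "\<lambda>k. r (s k)" "\<lambda>k. m (s k)"] by blast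
    qed
    then have "finite (SIGMA n:J. {..c n})" by auto
    then show ?thesis by (rule finite_subset[rotated]) (auto simp: J_def)
  qed
  have "\<psi> n m z = 0" if "z \<in> K" for n m z
    using \<psi>(4)[of z n m] that compactin_subset_topspace[OF K] by blast
  moreover have "\<forall>\<^sub>F m in sequentially. x n m \<in> U" if "openin X U" "K \<subseteq> U" for n U
  proof -
    obtain q where "q \<in> K" "limitin X (x n) q sequentially" using x unfolding sequence_fan_def by blast
    then show ?thesis using limitinD[OF _ that(1)] that(2) by blast
  qed
  ultimately have "bump_fan X (UNIV :: nat set) K x \<psi>"
    unfolding bump_fan_def using K \<psi>(1,2,3) fin by simp
  then show thesis by (rule that)
qed

text \<open>If the set \<open>B\<close> of limits of sequences in \<open>A\<close> is not closed,
  let \<open>z n\<close> in \<open>B\<close> converge to \<open>p\<close> outside \<open>B\<close>,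
  and approximate each \<open>z n\<close> from \<open>A\<close> inside \<open>nbd n (z n)\<close>. A
  convergent selection from these rows has the same limit as the \<open>z n\<close>, namely
  \<open>p\<close>, and would put \<open>p\<close> into \<open>B\<close>; so the rows form a fan
  over the sequence \<open>z\<close> with its limit.\<close>

lemma no_sequence_fan_imp_Frechet:
  assumes no: "\<And>K y. \<not> sequence_fan X K y"
    and A: "A \<subseteq> topspace X" and p: "p \<in> X closure_of A"
  obtains y where "\<And>n. y n \<in> A" "limitin X y p sequentially"
proof -
  define B where "B = {z. \<exists>y. (\<forall>n. y n \<in> A) \<and> limitin X y z sequentially}"
  have BX: "B \<subseteq> topspace X" using limitin_topspace by (auto simp: B_def)
  have "A \<subseteq> B"
  proof
    fix a assume a: "a \<in> A"
    then have "limitin X (\<lambda>_::nat. a) a sequentially" using A by (intro limitin_eventually) auto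
    then show "a \<in> B" using a by (auto simp: B_def)
  qed
  moreover have "closedin X B"
  proof (rule ccontr)
    assume "\<not> closedin X B"
    then obtain z p where z: "\<And>n. z n \<in> B" "p \<notin> B" "limitin X z p sequentially"
      by (rule not_closedin_imp_sequence[OF BX]) (rule that)
    have zX: "z n \<in> topspace X" for n using z(1) BX by blast
    have "\<exists>y. (\<forall>m. y m \<in> A \<and> y m \<in> nbd n (z n)) \<and> limitin X y (z n) sequentially" for n
    proof -
      obtain y where y: "\<And>m. y m \<in> A" "limitin X y (z n) sequentially"
        using z(1)[of n] unfolding B_def by blast
      obtain N where "\<And>m. m \<ge> N \<Longrightarrow> y m \<in> nbd n (z n)"
        using limitinD[OF y(2) openin_nbd[OF zX] mem_nbd[OF zX]] unfolding eventually_sequentially by blast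
      then show ?thesis
        using y(1) limitin_sequentially_offset[OF y(2), of N] by (intro exI[of _ "\<lambda>m. y (m + N)"]) auto
    qed
    then obtain y where y: "\<And>n m. y n m \<in> A" "\<And>n m. y n m \<in> nbd n (z n)"
        "\<And>n. limitin X (y n) (z n) sequentially"
      by metis
    have "sequence_fan X (insert p (range z)) y"
      unfolding sequence_fan_def
    proof (intro conjI allI impI notI)
      show "compactin X (insert p (range z))"
        by (rule compactin_sequence_with_limit[OF z(3)]) (use zX in auto)
      show "y n m \<in> topspace X" for n m using y(1) A by blast
      show "\<exists>q\<in>insert p (range z). limitin X (y n) q sequentially" for n using y(3) by blast
      fix f r q assume r: "strict_mono (r :: nat \<Rightarrow> nat)" and lim: "limitin X (\<lambda>k. y (r k) (f k)) q sequentially"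
      have "limitin X (\<lambda>k. z (r k)) q sequentially"
        by (rule nbd_reflects_limits[OF lim filterlim_subseq[OF r]]) (use zX y(2) in auto)
      moreover have "limitin X (\<lambda>k. z (r k)) p sequentially"
        using limitin_subsequence[OF r z(3)] by (simp add: comp_def)
      ultimately have "q = p" by (rule limit_unique)
      then have "p \<in> B" unfolding B_def
        using lim y(1) by (intro CollectI exI[of _ "\<lambda>k. y (r k) (f k)"]) simp
      then show False using z(2) by simp
    qed
    then show False using no by blast
  qed
  ultimately have "X closure_of A \<subseteq> B" by (rule closure_of_minimal)
  then show thesis using p that unfolding B_def by blast
qed

text \<open>
  The base at \<open>p\<close> consists of the interiors of finite unions from a countable \<open>\<Q> \<subseteq> \<P>\<close>, closed under the
  following step: whenever a finite union from \<open>\<Q>\<close> is not a neighbourhood of \<open>p\<close>, choose a sequence that converges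
  to \<open>p\<close> outside it and add all members of \<open>\<P>\<close> meeting this sequence.
\<close>

lemma no_sequence_fan_imp_first_countable:
  assumes no: "\<And>K y. \<not> sequence_fan X K y"
    and \<P>: "k_network X \<P>" "point_countable X \<P>"
  shows "first_countable X"
  unfolding first_countable_def
proof
  fix p assume p: "p \<in> topspace X"
  have "\<exists>y. (\<forall>n. y n \<in> topspace X - S) \<and> limitin X y p sequentially" if "p \<notin> X interior_of S" for S
  proof -
    have "p \<in> X closure_of (topspace X - S)"
      using p that by (simp add: closure_of_complement)
    then obtain y where "\<And>n. y n \<in> topspace X - S" "limitin X y p sequentially"
      by (rule no_sequence_fan_imp_Frechet[OF no Diff_subset]) (rule that)
    then show ?thesis by blast
  qed
  then obtain L where L: "\<And>S n. p \<notin> X interior_of S \<Longrightarrow> L S n \<in> topspace X - S"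
      "\<And>S. p \<notin> X interior_of S \<Longrightarrow> limitin X (L S) p sequentially"
    by metis
  define step where "step \<C> = \<C> \<union> (\<Union>\<R>\<in>{\<R>. finite \<R> \<and> \<R> \<subseteq> \<C>} \<inter> {\<R>. p \<notin> X interior_of \<Union>\<R>}.
      \<Union>n. {P \<in> \<P>. L (\<Union>\<R>) n \<in> P})" for \<C>
  define \<Q> where "\<Q> n = (step ^^ n) {}" for n
  have \<Q>_Suc: "\<Q> (Suc n) = step (\<Q> n)" for n by (simp add: \<Q>_def)
  have cnt: "countable (\<Q> n)" for n
  proof (induction n)
    case 0
    show ?case by (simp add: \<Q>_def)
  next
    case (Suc n)
    have "countable {P \<in> \<P>. L (\<Union>\<R>) k \<in> P}" if "p \<notin> X interior_of \<Union>\<R>" for \<R> k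
      using \<P>(2) L(1)[OF that, of k] unfolding point_countable_def by blast
    then show ?case
      unfolding \<Q>_Suc step_def using Suc countable_Collect_finite_subset[OF Suc] by auto
  qed
  have mono: "\<Q> m \<subseteq> \<Q> n" if "m \<le> n" for m n
    by (rule lift_Suc_mono_le[OF _ that]) (auto simp: \<Q>_Suc step_def)
  let ?Q = "\<Union>n. \<Q> n"
  have cntQ: "countable ?Q" using cnt by blast
  have closed: "P \<in> ?Q"
    if "finite \<R>" "\<R> \<subseteq> ?Q" "p \<notin> X interior_of \<Union>\<R>" "P \<in> \<P>" "L (\<Union>\<R>) k \<in> P" for \<R> P k
  proof -
    have "\<exists>n. \<R> \<subseteq> \<Q> n" using that(1,2)
    proof (induction \<R> rule: finite_induct)
      case (insert R \<R>)
      then obtain m n where "\<R> \<subseteq> \<Q> m" "R \<in> \<Q> n" by blast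
      then have "insert R \<R> \<subseteq> \<Q> (max m n)" using mono[of m "max m n"] mono[of n "max m n"] by auto
      then show ?case by blast
    qed simp
    then obtain n where "\<R> \<subseteq> \<Q> n" by blast
    then have "P \<in> \<Q> (Suc n)" unfolding \<Q>_Suc step_def using that by blast
    then show ?thesis by blast
  qed
  define \<B> where "\<B> = (\<lambda>\<R>. X interior_of \<Union>\<R>) ` {\<R>. finite \<R> \<and> \<R> \<subseteq> ?Q}"
  have "\<exists>V\<in>\<B>. p \<in> V \<and> V \<subseteq> U" if U: "openin X U" "p \<in> U" for U
  proof (rule ccontr)
    assume contra: "\<not> ?thesis"
    have bad: "p \<notin> X interior_of \<Union>\<R>" if "finite \<R>" "\<R> \<subseteq> ?Q" "\<Union>\<R> \<subseteq> U" for \<R>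
    proof
      assume "p \<in> X interior_of \<Union>\<R>"
      moreover have "X interior_of \<Union>\<R> \<subseteq> U" using interior_of_subset[of X "\<Union>\<R>"] that(3) by (rule order_trans)
      moreover have "X interior_of \<Union>\<R> \<in> \<B>" using that by (auto simp: \<B>_def)
      ultimately show False using contra by blast
    qed
    define QU where "QU = {Q \<in> ?Q. Q \<subseteq> U}"
    have "QU \<noteq> {}"
    proof -
      \<comment> \<open>The empty family seeds the construction: the interior of its union is empty,
        so it is never a neighbourhood of \<open>p\<close>.\<close>
      have b: "p \<notin> X interior_of \<Union>{}" by (rule bad) auto
      obtain P where P: "P \<in> \<P>" "P \<subseteq> U" "infinite {n. L (\<Union>{}) n \<in> P}"
        by (rule k_network_frequently[OF \<P>(1) L(2)[OF b] U])
      then obtain n where "L (\<Union>{}) n \<in> P" using not_finite_existsD by blast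
      then have "P \<in> ?Q" using closed[of "{}" P n] b P(1) by simp
      then show ?thesis using P(2) by (auto simp: QU_def)
    qed
    moreover have "countable QU" unfolding QU_def by (rule countable_subset[OF _ cntQ]) blast
    ultimately have e: "range (from_nat_into QU) = QU" by (rule range_from_nat_into)
    define R where "R n = from_nat_into QU ` {..n}" for n
    have R: "finite (R n)" "R n \<subseteq> ?Q" "\<Union>(R n) \<subseteq> U" for n
    proof -
      have "R n \<subseteq> range (from_nat_into QU)" unfolding R_def by blast
      then have "R n \<subseteq> QU" unfolding e .
      then show "R n \<subseteq> ?Q" "\<Union>(R n) \<subseteq> U" by (auto simp: QU_def)
    qed (simp add: R_def)
    have badR: "p \<notin> X interior_of \<Union>(R n)" for n by (rule bad[OF R])
    have "\<exists>t. \<forall>m\<ge>t. L (\<Union>(R n)) m \<in> nbd n p" for n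
      using limitinD[OF L(2)[OF badR] openin_nbd[OF p] mem_nbd[OF p]] unfolding eventually_sequentially .
    then obtain t where t: "\<And>n m. m \<ge> t n \<Longrightarrow> L (\<Union>(R n)) m \<in> nbd n p" by metis
    define y where "y n m = L (\<Union>(R n)) (m + t n)" for n m
    \<comment> \<open>A convergent selection tends to \<open>p\<close>, so some \<open>P\<close>
      inside \<open>U\<close> catches it infinitely often. By closure under the step
      \<open>P\<close> is listed in \<open>QU\<close>, hence lies in \<open>R n\<close> for all
      large \<open>n\<close>, while row \<open>n\<close> avoids
      \<open>\<Union>(R n)\<close>.\<close>
    have "sequence_fan X {p} y"
      unfolding sequence_fan_def
    proof (intro conjI allI impI notI)
      show "compactin X {p}" using p by simp
      show "y n m \<in> topspace X" for n m unfolding y_def using L(1)[OF badR] by blast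
      show "\<exists>q\<in>{p}. limitin X (y n) q sequentially" for n
        unfolding y_def using limitin_sequentially_offset[OF L(2)[OF badR]] by blast
      fix f r q assume r: "strict_mono (r :: nat \<Rightarrow> nat)" and lim: "limitin X (\<lambda>k. y (r k) (f k)) q sequentially"
      have "limitin X (\<lambda>_::nat. p) q sequentially"
        by (rule nbd_reflects_limits[OF lim filterlim_subseq[OF r]]) (use p t in \<open>auto simp: y_def\<close>)
      moreover have "limitin X (\<lambda>_::nat. p) p sequentially" using p by (intro limitin_eventually) auto
      ultimately have "q = p" by (rule limit_unique)
      then have lim_p: "limitin X (\<lambda>k. y (r k) (f k)) p sequentially" using lim by simp
      obtain P where P: "P \<in> \<P>" "P \<subseteq> U" "infinite {k. y (r k) (f k) \<in> P}"
        by (rule k_network_frequently[OF \<P>(1) lim_p U])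
      then obtain k where "y (r k) (f k) \<in> P" using not_finite_existsD by blast
      then have "P \<in> ?Q" using closed[OF R(1,2) badR P(1)] unfolding y_def by blast
      then have "P \<in> QU" using P(2) by (simp add: QU_def)
      then obtain i where i: "P = from_nat_into QU i" using e by blast
      obtain k' where k': "k' \<ge> i" "y (r k') (f k') \<in> P"
        using P(3) by (auto simp: infinite_nat_iff_unbounded_le)
      have "i \<le> r k'" using k'(1) seq_suble[OF r, of k'] by simp
      then have "P \<in> R (r k')" by (auto simp: R_def i)
      then show False using k'(2) L(1)[OF badR, of "r k'" "f k' + t (r k')"] unfolding y_def by blast
    qed
    then show False using no by blast
  qed
  moreover have "countable \<B>"
    unfolding \<B>_def by (intro countable_image countable_Collect_finite_subset cntQ)
  moreover have "openin X V" if "V \<in> \<B>" for V using that by (auto simp: \<B>_def)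
  ultimately show "\<exists>\<B>. countable \<B> \<and> (\<forall>V\<in>\<B>. openin X V) \<and>
      (\<forall>U. openin X U \<and> p \<in> U \<longrightarrow> (\<exists>V\<in>\<B>. p \<in> V \<and> V \<subseteq> U))"
    by blast
qed

end

section \<open>Products\<close>

lemma k_space_imp_kR_space:
  assumes "tychonoff_space X" "k_space X"
  shows "kR_space X"
  unfolding kR_space_def using assms continuous_map_from_k_space[OF assms(2)] by blast

lemma tychonoff_space_prod_topology:
  assumes "tychonoff_space X" "tychonoff_space Y"
  shows "tychonoff_space (prod_topology X Y)"
proof -
  have "Hausdorff_space (prod_topology X Y)"
    using assms by (simp add: tychonoff_imp_Hausdorff Hausdorff_space_prod_topology)
  then show ?thesis
    using assms by (simp add: tychonoff_space_def completely_regular_space_prod_topology Hausdorff_imp_t1_space)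
qed

lemma first_countable_decreasing_base:
  assumes "first_countable X" "p \<in> topspace X"
  shows "\<exists>V :: nat \<Rightarrow> 'a set. (\<forall>n. openin X (V n)) \<and> (\<forall>n. p \<in> V n) \<and>
    (\<forall>U. openin X U \<and> p \<in> U \<longrightarrow> (\<exists>N. \<forall>n\<ge>N. V n \<subseteq> U))"
proof -
  obtain \<B> where \<B>: "countable \<B>" "\<And>V. V \<in> \<B> \<Longrightarrow> openin X V"
      "\<And>U. openin X U \<Longrightarrow> p \<in> U \<Longrightarrow> \<exists>V\<in>\<B>. p \<in> V \<and> V \<subseteq> U"
    using assms unfolding first_countable_def by metis
  define \<C> where "\<C> = {V \<in> \<B>. p \<in> V}"
  have "\<C> \<noteq> {}" using \<B>(3)[OF openin_topspace assms(2)] by (auto simp: \<C>_def)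
  moreover have "countable \<C>" using \<B>(1) by (simp add: \<C>_def)
  ultimately have rng: "range (from_nat_into \<C>) = \<C>" by (rule range_from_nat_into)
  have e: "openin X (from_nat_into \<C> n)" "p \<in> from_nat_into \<C> n" for n
  proof -
    have "from_nat_into \<C> n \<in> \<C>" using rng by blast
    then show "openin X (from_nat_into \<C> n)" "p \<in> from_nat_into \<C> n"
      using \<B>(2) by (auto simp: \<C>_def)
  qed
  show ?thesis
  proof (intro exI[of _ "\<lambda>n. \<Inter>i\<le>n. from_nat_into \<C> i"] conjI)
    show "\<forall>n. openin X (\<Inter>i\<le>n. from_nat_into \<C> i)"
      using e(1) by (intro allI openin_INT2) auto
    show "\<forall>n. p \<in> (\<Inter>i\<le>n. from_nat_into \<C> i)" using e(2) by blast
    show "\<forall>U. openin X U \<and> p \<in> U \<longrightarrow> (\<exists>N. \<forall>n\<ge>N. (\<Inter>i\<le>n. from_nat_into \<C> i) \<subseteq> U)"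
    proof (intro allI impI, elim conjE)
      fix U assume "openin X U" "p \<in> U"
      then obtain V where V: "V \<in> \<C>" "V \<subseteq> U" using \<B>(3)[of U] by (auto simp: \<C>_def)
      then obtain N where "V = from_nat_into \<C> N" using rng by blast
      then have "(\<Inter>i\<le>n. from_nat_into \<C> i) \<subseteq> U" if "n \<ge> N" for n
        using V(2) that by blast
      then show "\<exists>N. \<forall>n\<ge>N. (\<Inter>i\<le>n. from_nat_into \<C> i) \<subseteq> U" by blast
    qed
  qed
qed

text \<open>A closure point of \<open>S\<close> is the limit of a sequence in \<open>S\<close>, and
  this sequence with its limit is a compact set on which \<open>S\<close> is already known to be
  closed.\<close>

lemma first_countable_prod_imp_k_space:
  fixes X :: "'a topology" and Y :: "'b topology"
  assumes X: "first_countable X" and Y: "first_countable Y"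
    and H: "Hausdorff_space (prod_topology X Y)"
  shows "k_space (prod_topology X Y)"
  unfolding Abstract_Topological_Spaces.k_space
proof (intro allI impI, elim conjE)
  let ?P = "prod_topology X Y"
  fix S assume S: "S \<subseteq> topspace ?P"
    and cl: "\<forall>K. compactin ?P K \<longrightarrow> closedin (subtopology ?P K) (K \<inter> S)"
  have "X' \<in> S" if X': "X' \<in> ?P closure_of S" for X'
  proof -
    obtain p q where pq: "X' = (p, q)" by (cases X')
    have top: "p \<in> topspace X" "q \<in> topspace Y"
      using X' closure_of_subset_topspace[of ?P S] by (auto simp: pq)
    obtain V :: "nat \<Rightarrow> 'a set" where V': "\<forall>n. openin X (V n)" "\<forall>n. p \<in> V n"
        "\<forall>U. openin X U \<and> p \<in> U \<longrightarrow> (\<exists>N. \<forall>n\<ge>N. V n \<subseteq> U)"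
      using first_countable_decreasing_base[OF X top(1)] by (elim exE conjE) (rule that)
    note V = V'(1,2)[rule_format] V'(3)
    obtain W :: "nat \<Rightarrow> 'b set" where W': "\<forall>n. openin Y (W n)" "\<forall>n. q \<in> W n"
        "\<forall>U. openin Y U \<and> q \<in> U \<longrightarrow> (\<exists>N. \<forall>n\<ge>N. W n \<subseteq> U)"
      using first_countable_decreasing_base[OF Y top(2)] by (elim exE conjE) (rule that)
    note W = W'(1,2)[rule_format] W'(3)
    have "\<exists>s\<in>S. s \<in> V n \<times> W n" for n
    proof -
      have 1: "openin ?P (V n \<times> W n)" using V(1) W(1) by (simp add: openin_prod_Times_iff)
      have 2: "X' \<in> V n \<times> W n" using V(2) W(2) by (simp add: pq)
      have "\<forall>T. X' \<in> T \<and> openin ?P T \<longrightarrow> (\<exists>y. y \<in> S \<and> y \<in> T)"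
        using X' unfolding in_closure_of by (rule conjunct2)
      from this[rule_format, OF conjI[OF 2 1]] show ?thesis by (elim exE conjE) (rule bexI)
    qed
    then obtain s where s: "\<And>n. s n \<in> S" "\<And>n. s n \<in> V n \<times> W n" by metis
    have lim: "limitin ?P s X' sequentially"
      unfolding limitin_sequentially
    proof (intro conjI allI impI)
      show "X' \<in> topspace ?P" using top by (simp add: pq)
      fix U assume "openin ?P U \<and> X' \<in> U"
      then obtain A B where AB: "openin X A" "openin Y B" "p \<in> A" "q \<in> B" "A \<times> B \<subseteq> U"
        unfolding openin_prod_topology_alt pq by blast
      obtain N M where "\<forall>n\<ge>N. V n \<subseteq> A" "\<forall>n\<ge>M. W n \<subseteq> B"
        using V(3)[rule_format, OF conjI[OF AB(1,3)]] W(3)[rule_format, OF conjI[OF AB(2,4)]] by blast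
      then have "s n \<in> U" if "n \<ge> max N M" for n
      proof -
        have "V n \<times> W n \<subseteq> A \<times> B"
          using \<open>\<forall>n\<ge>N. V n \<subseteq> A\<close> \<open>\<forall>n\<ge>M. W n \<subseteq> B\<close> that by (intro Sigma_mono) auto
        from subsetD[OF this s(2)] show ?thesis by (rule subsetD[OF AB(5)])
      qed
      then show "\<exists>N. \<forall>n\<ge>N. s n \<in> U" by blast
    qed
    let ?K = "insert X' (range s)"
    have "range s \<subseteq> topspace ?P" using s(1) S by (intro image_subsetI) (rule subsetD)
    then have K: "compactin ?P ?K"
      by (rule compactin_sequence_with_limit[OF lim order_refl])
    then have "closedin ?P ?K" using H by (simp add: compactin_imp_closedin)
    then have "closedin ?P (?K \<inter> S)" using cl K closedin_trans_full by blast
    then have "X' \<in> ?K \<inter> S" by (rule limitin_closedin[OF lim]) (use s(1) in auto)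
    then show ?thesis by blast
  qed
  then show "closedin ?P S"
    using S closure_of_subset_eq[of S ?P] by blast
qed

text \<open>One enlargement step for \<open>k_omega_prod_imp_k_space\<close>: Wallace's theorem
  gives an open box, and regularity with compactness fits compact neighbourhoods into its
  sides.\<close>

lemma regular_compact_prod_neighbourhood:
  fixes X :: "'a topology" and Y :: "'b topology"
  assumes X: "regular_space X" "compact_space X" and Y: "regular_space Y" "compact_space Y"
    and A: "compactin X A" and B: "compactin Y B"
    and W: "openin (prod_topology X Y) W" "A \<times> B \<subseteq> W"
  obtains U C V D where "openin X U" "compactin X C" "A \<subseteq> U" "U \<subseteq> C"
    "openin Y V" "compactin Y D" "B \<subseteq> V" "V \<subseteq> D" "C \<times> D \<subseteq> W"
proof -
  have *: "\<exists>U C. openin Z U \<and> compactin Z C \<and> K \<subseteq> U \<and> U \<subseteq> C \<and> C \<subseteq> O'"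
    if Z: "regular_space Z" "compact_space Z" and K: "compactin Z K" and O': "openin Z O'" "K \<subseteq> O'"
    for Z :: "'z topology" and K O'
  proof -
    have nb: "neighbourhood_base_of (closedin Z) Z"
      using Z(1) by (simp add: neighbourhood_base_of_closedin)
    have "\<exists>U C. openin Z U \<and> closedin Z C \<and> x \<in> U \<and> U \<subseteq> C \<and> C \<subseteq> O'" if "x \<in> K" for x
    proof -
      have "x \<in> O'" using that O'(2) by blast
      then show ?thesis using nb O'(1) unfolding neighbourhood_base_of by meson
    qed
    then obtain U C where UC: "\<And>x. x \<in> K \<Longrightarrow> openin Z (U x)" "\<And>x. x \<in> K \<Longrightarrow> closedin Z (C x)"
        "\<And>x. x \<in> K \<Longrightarrow> x \<in> U x" "\<And>x. x \<in> K \<Longrightarrow> U x \<subseteq> C x" "\<And>x. x \<in> K \<Longrightarrow> C x \<subseteq> O'"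
      by metis
    obtain F where F: "finite F" "F \<subseteq> K" "K \<subseteq> (\<Union>x\<in>F. U x)"
      by (rule compactin_point_cover[OF K, of U]) (use UC in auto)
    have "openin Z (\<Union>x\<in>F. U x)" using UC(1) F(2) by (intro openin_Union) auto
    moreover have "closedin Z (\<Union>x\<in>F. C x)" using UC(2) F(1,2) by (intro closedin_Union) auto
    then have "compactin Z (\<Union>x\<in>F. C x)" using Z(2) by (rule closedin_compact_space[rotated])
    moreover have "(\<Union>x\<in>F. U x) \<subseteq> (\<Union>x\<in>F. C x)" "(\<Union>x\<in>F. C x) \<subseteq> O'"
      using UC(4,5) F(2) by blast+
    ultimately show ?thesis using F(3) by blast
  qed
  obtain U0 V0 where UV0: "openin X U0" "openin Y V0" "A \<subseteq> U0" "B \<subseteq> V0" "U0 \<times> V0 \<subseteq> W"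
    by (rule Wallace_theorem_prod_topology[OF A B W])
  obtain U C where UC: "openin X U" "compactin X C" "A \<subseteq> U" "U \<subseteq> C" "C \<subseteq> U0"
    using *[OF X A UV0(1,3)] by blast
  obtain V D where VD: "openin Y V" "compactin Y D" "B \<subseteq> V" "V \<subseteq> D" "D \<subseteq> V0"
    using *[OF Y B UV0(2,4)] by blast
  have "C \<times> D \<subseteq> W" using UC(5) VD(5) UV0(5) by blast
  then show thesis by (rule that[OF UC(1-4) VD(1-4)])
qed

section \<open>Products of k_omega-spaces\<close>

lemma k_omega_increasing_compacta:
  fixes Z :: "'a topology"
  assumes "k_omega_space Z" "p \<in> topspace Z"
  shows "\<exists>K :: nat \<Rightarrow> 'a set. (\<forall>n. compactin Z (K n)) \<and> (\<forall>n. p \<in> K n) \<and> (\<forall>m n. m \<le> n \<longrightarrow> K m \<subseteq> K n) \<and>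
    (\<forall>E. E \<subseteq> topspace Z \<and> (\<forall>n. openin (subtopology Z (K n)) (E \<inter> K n)) \<longrightarrow> openin Z E)"
proof -
  obtain K :: "nat \<Rightarrow> 'a set" where K': "\<forall>n. compactin Z (K n)"
      "\<forall>F. F \<subseteq> topspace Z \<and> (\<forall>n. closedin (subtopology Z (K n)) (F \<inter> K n)) \<longrightarrow> closedin Z F"
    using assms(1) unfolding k_omega_space_def by (elim exE conjE) (rule that)
  have K: "\<And>n. compactin Z (K n)"
      "\<And>F. F \<subseteq> topspace Z \<Longrightarrow> (\<And>n. closedin (subtopology Z (K n)) (F \<inter> K n)) \<Longrightarrow> closedin Z F"
    using K' by simp_all
  \<comment> \<open>The compact sets need not cover the space, so \<open>p\<close> is inserted by
    hand.\<close>
  define L where "L n = insert p (\<Union>i\<le>n. K i)" for n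
  show ?thesis
  proof (intro exI[of _ L] conjI)
    show "\<forall>n. compactin Z (L n)"
    proof
      fix n
      have "compactin Z ({p} \<union> (\<Union>i\<le>n. K i))"
        using assms(2) K(1) by (intro compactin_Un compactin_Union) auto
      then show "compactin Z (L n)" by (simp add: L_def)
    qed
    show "\<forall>n. p \<in> L n" by (simp add: L_def)
    show "\<forall>m n. m \<le> n \<longrightarrow> L m \<subseteq> L n"
    proof (intro allI impI)
      fix m n :: nat
      assume "m \<le> n"
      then have "{..m} \<subseteq> {..n}" by auto
      then show "L m \<subseteq> L n" unfolding L_def by (intro insert_mono UN_mono) simp_all
    qed
    show "\<forall>E. E \<subseteq> topspace Z \<and> (\<forall>n. openin (subtopology Z (L n)) (E \<inter> L n)) \<longrightarrow> openin Z E"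
    proof (intro allI impI, elim conjE)
      fix E assume E: "E \<subseteq> topspace Z" "\<forall>n. openin (subtopology Z (L n)) (E \<inter> L n)"
      have "closedin (subtopology Z (K n)) ((topspace Z - E) \<inter> K n)" for n
      proof -
        have "openin (subtopology (subtopology Z (L n)) (K n)) (E \<inter> L n \<inter> K n)"
          using E(2) by (simp add: openin_subtopology_Int)
        moreover have "L n \<inter> K n = K n" by (auto simp: L_def)
        moreover have "E \<inter> L n \<inter> K n = E \<inter> K n" by (auto simp: L_def)
        ultimately have "openin (subtopology Z (K n)) (E \<inter> K n)"
          by (simp add: subtopology_subtopology)
        moreover have "topspace (subtopology Z (K n)) - E \<inter> K n = (topspace Z - E) \<inter> K n"
          by auto
        ultimately show ?thesis by (metis closedin_diff closedin_topspace openin_closedin_eq openin_subset double_diff closedin_def Diff_subset)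
      qed
      then have "closedin Z (topspace Z - E)" by (intro K(2)) auto
      then show "openin Z E" using E(1) by (simp add: openin_closedin_eq)
    qed
  qed
qed

text \<open>A point of the union lying in \<open>K m\<close> is in some \<open>C k\<close> with
  \<open>k \<ge> m\<close>, hence in the interior of \<open>C (Suc k)\<close> relative to
  \<open>K (Suc k)\<close>. As \<open>K m\<close> is a subset of \<open>K (Suc k)\<close>, the union
  has a relatively open trace on every \<open>K m\<close>.\<close>

lemma k_omega_exhausting_neighbourhoods_open:
  assumes K: "\<And>m n. m \<le> n \<Longrightarrow> K m \<subseteq> K n" "\<And>n. K n \<subseteq> topspace Z"
      "\<forall>E. E \<subseteq> topspace Z \<and> (\<forall>n. openin (subtopology Z (K n)) (E \<inter> K n)) \<longrightarrow> openin Z E"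
    and C: "\<And>n. C n \<subseteq> K n"
      "\<And>n. \<exists>U. openin (subtopology Z (K (Suc n))) U \<and> C n \<subseteq> U \<and> U \<subseteq> C (Suc n)"
  shows "openin Z (\<Union>n. C n)" and "m \<le> n \<Longrightarrow> C m \<subseteq> C n"
proof -
  have mono: "C m \<subseteq> C n" if "m \<le> n" for m n
    by (rule lift_Suc_mono_le[OF _ that]) (use C(2) in blast)
  then show "m \<le> n \<Longrightarrow> C m \<subseteq> C n" .
  have "openin (subtopology Z (K m)) ((\<Union>n. C n) \<inter> K m)" for m
  proof (subst openin_subopen, rule ballI)
    fix x assume x: "x \<in> (\<Union>n. C n) \<inter> K m"
    then obtain k where "x \<in> C k" by blast
    then have xC: "x \<in> C (max k m)" using mono[of k "max k m"] by auto
    obtain U where U: "openin (subtopology Z (K (Suc (max k m)))) U" "C (max k m) \<subseteq> U" "U \<subseteq> C (Suc (max k m))"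
      using C(2) by blast
    then obtain O' where O': "openin Z O'" "U = O' \<inter> K (Suc (max k m))"
      unfolding openin_subtopology by blast
    have "K m \<subseteq> K (Suc (max k m))" by (rule K(1)) simp
    then have "O' \<inter> K m \<subseteq> (\<Union>n. C n) \<inter> K m" using O'(2) U(3) by blast
    moreover have "x \<in> O' \<inter> K m" using x xC U(2) O'(2) by blast
    moreover have "openin (subtopology Z (K m)) (O' \<inter> K m)" using O'(1) by (rule openin_subtopology_Int)
    ultimately show "\<exists>T. openin (subtopology Z (K m)) T \<and> x \<in> T \<and> T \<subseteq> (\<Union>n. C n) \<inter> K m" by blast
  qed
  moreover have "(\<Union>n. C n) \<subseteq> topspace Z" using C(1) K(2) by blast
  ultimately show "openin Z (\<Union>n. C n)" using K(3) by blast
qed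

text \<open>Compact boxes inside \<open>S\<close> are grown from the point \<open>(p, q)\<close>,
  each side lying in the relative interior of the next. The unions of the sides are open in the
  factors, and since the boxes increase, the product of the unions is still inside
  \<open>S\<close>.\<close>

lemma k_omega_prod_imp_k_space:
  fixes X :: "'a topology" and Y :: "'b topology"
  assumes X: "k_omega_space X" "regular_space X" and Y: "k_omega_space Y" "regular_space Y"
  shows "k_space (prod_topology X Y)"
  unfolding k_space_open
proof (intro allI impI, elim conjE)
  let ?P = "prod_topology X Y"
  fix S assume S: "S \<subseteq> topspace ?P"
    and S_open: "\<forall>K. compactin ?P K \<longrightarrow> openin (subtopology ?P K) (K \<inter> S)"
  show "openin ?P S"
  proof (subst openin_subopen, rule ballI)
    fix v assume v: "v \<in> S"
    obtain p q where pq: "v = (p, q)" by (cases v)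
    have pX: "p \<in> topspace X" and qY: "q \<in> topspace Y" using v S by (auto simp: pq)
    obtain K :: "nat \<Rightarrow> 'a set" where K': "\<forall>n. compactin X (K n)" "\<forall>n. p \<in> K n" "\<forall>m n. m \<le> n \<longrightarrow> K m \<subseteq> K n"
        "\<forall>E. E \<subseteq> topspace X \<and> (\<forall>n. openin (subtopology X (K n)) (E \<inter> K n)) \<longrightarrow> openin X E"
      using k_omega_increasing_compacta[OF X(1) pX] by (elim exE conjE) (rule that)
    note K = K'(1-3)[rule_format] K'(4)
    obtain L :: "nat \<Rightarrow> 'b set" where L': "\<forall>n. compactin Y (L n)" "\<forall>n. q \<in> L n" "\<forall>m n. m \<le> n \<longrightarrow> L m \<subseteq> L n"
        "\<forall>E. E \<subseteq> topspace Y \<and> (\<forall>n. openin (subtopology Y (L n)) (E \<inter> L n)) \<longrightarrow> openin Y E"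
      using k_omega_increasing_compacta[OF Y(1) qY] by (elim exE conjE) (rule that)
    note L = L'(1-3)[rule_format] L'(4)
    define good where "good n CD \<longleftrightarrow> compactin X (fst CD) \<and> fst CD \<subseteq> K n \<and> compactin Y (snd CD) \<and>
        snd CD \<subseteq> L n \<and> p \<in> fst CD \<and> q \<in> snd CD \<and> fst CD \<times> snd CD \<subseteq> S" for n CD
    define next_to where "next_to n CD CD' \<longleftrightarrow>
        (\<exists>U. openin (subtopology X (K (Suc n))) U \<and> fst CD \<subseteq> U \<and> U \<subseteq> fst CD') \<and>
        (\<exists>V. openin (subtopology Y (L (Suc n))) V \<and> snd CD \<subseteq> V \<and> V \<subseteq> snd CD')" for n CD CD'
    have "\<exists>f. \<forall>n. good n (f n) \<and> next_to n (f n) (f (Suc n))"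
    proof (rule dependent_nat_choice)
      show "\<exists>CD. good 0 CD"
        by (rule exI[of _ "({p}, {q})"]) (use pX qY K(2) L(2) v in \<open>auto simp: good_def pq\<close>)
      fix CD n assume g: "good n CD"
      obtain C D where CD: "CD = (C, D)" by (cases CD)
      let ?X = "subtopology X (K (Suc n))" and ?Y = "subtopology Y (L (Suc n))"
      have C: "compactin X C" "C \<subseteq> K (Suc n)" "p \<in> C" and D: "compactin Y D" "D \<subseteq> L (Suc n)" "q \<in> D"
        and CDS: "C \<times> D \<subseteq> S"
        using g K(3)[of n "Suc n"] L(3)[of n "Suc n"] by (auto simp: good_def CD)
      \<comment> \<open>Inside the next compact box \<open>S\<close> is relatively open by
        hypothesis, which leaves room for the enlargement.\<close>
      have "compactin ?P (K (Suc n) \<times> L (Suc n))"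
        using K(1) L(1) by (simp add: compactin_Times)
      then have "openin (subtopology ?P (K (Suc n) \<times> L (Suc n))) ((K (Suc n) \<times> L (Suc n)) \<inter> S)"
        using S_open by blast
      then have W: "openin (prod_topology ?X ?Y) ((K (Suc n) \<times> L (Suc n)) \<inter> S)"
        by (simp add: subtopology_Times)
      have CDW: "C \<times> D \<subseteq> (K (Suc n) \<times> L (Suc n)) \<inter> S" using C D CDS by blast
      have reg: "regular_space ?X" "regular_space ?Y"
        using X(2) Y(2) by (simp_all add: regular_space_subtopology)
      have cpt: "compact_space ?X" "compact_space ?Y"
        using K(1) L(1) by (simp_all add: compact_space_subtopology)
      have CD': "compactin ?X C" "compactin ?Y D"
        using C D by (simp_all add: compactin_subtopology)
      obtain U C' V D' where UV: "openin ?X U" "compactin ?X C'" "C \<subseteq> U" "U \<subseteq> C'"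
          "openin ?Y V" "compactin ?Y D'" "D \<subseteq> V" "V \<subseteq> D'" "C' \<times> D' \<subseteq> (K (Suc n) \<times> L (Suc n)) \<inter> S"
        by (rule regular_compact_prod_neighbourhood[OF reg(1) cpt(1) reg(2) cpt(2) CD' W CDW])
      have "good (Suc n) (C', D')"
        using UV C D by (auto simp: good_def compactin_subtopology)
      moreover have "next_to n CD (C', D')"
        using UV by (auto simp: next_to_def CD)
      ultimately show "\<exists>CD'. good (Suc n) CD' \<and> next_to n CD CD'" by blast
    qed
    then obtain f where f: "\<And>n. good n (f n)" "\<And>n. next_to n (f n) (f (Suc n))" by blast
    let ?C = "\<lambda>n. fst (f n)" and ?D = "\<lambda>n. snd (f n)"
    have KX: "K n \<subseteq> topspace X" and LY: "L n \<subseteq> topspace Y" for n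
      using K(1) L(1) compactin_subset_topspace by blast+
    have C: "?C n \<subseteq> K n" "\<exists>U. openin (subtopology X (K (Suc n))) U \<and> ?C n \<subseteq> U \<and> U \<subseteq> ?C (Suc n)"
      and D: "?D n \<subseteq> L n" "\<exists>U. openin (subtopology Y (L (Suc n))) U \<and> ?D n \<subseteq> U \<and> U \<subseteq> ?D (Suc n)" for n
      using f(1)[of n] f(2)[of n] by (simp_all add: good_def next_to_def)
    note GC = k_omega_exhausting_neighbourhoods_open[where C = ?C, OF K(3) KX K(4) C]
    note GD = k_omega_exhausting_neighbourhoods_open[where C = ?D, OF L(3) LY L(4) D]
    have "openin ?P ((\<Union>n. ?C n) \<times> (\<Union>n. ?D n))"
      using GC(1) GD(1) by (simp add: openin_prod_Times_iff)
    moreover have "v \<in> (\<Union>n. ?C n) \<times> (\<Union>n. ?D n)"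
      using f(1)[of 0] by (auto simp: pq good_def)
    moreover have "(\<Union>n. ?C n) \<times> (\<Union>n. ?D n) \<subseteq> S"
    proof clarify
      fix x y m n assume "x \<in> ?C m" "y \<in> ?D n"
      then have "x \<in> ?C (max m n)" "y \<in> ?D (max m n)"
        using GC(2)[of m "max m n"] GD(2)[of n "max m n"] by auto
      then show "(x, y) \<in> S" using f(1)[of "max m n"] by (auto simp: good_def)
    qed
    ultimately show "\<exists>T. openin ?P T \<and> v \<in> T \<and> T \<subseteq> S" by blast
  qed
qed

lemma locally_k_omega_prod_imp_k_space:
  fixes X :: "'a topology" and Y :: "'b topology"
  assumes X: "locally_k_omega_space X" "regular_space X" and Y: "locally_k_omega_space Y" "regular_space Y"
  shows "k_space (prod_topology X Y)"
  unfolding k_space_open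
proof (intro allI impI, elim conjE)
  let ?P = "prod_topology X Y"
  fix S assume S: "S \<subseteq> topspace ?P"
    and S_open: "\<forall>K. compactin ?P K \<longrightarrow> openin (subtopology ?P K) (K \<inter> S)"
  show "openin ?P S"
  proof (subst openin_subopen, rule ballI)
    fix v assume v: "v \<in> S"
    obtain p q where pq: "v = (p, q)" by (cases v)
    have pX: "p \<in> topspace X" and qY: "q \<in> topspace Y" using v S by (auto simp: pq)
    obtain U N where UN: "openin X U" "p \<in> U" "U \<subseteq> N" "N \<subseteq> topspace X" "k_omega_space (subtopology X N)"
      using bspec[OF X(1)[unfolded locally_k_omega_space_def] pX] by (elim exE conjE)
    obtain V M where VM: "openin Y V" "q \<in> V" "V \<subseteq> M" "M \<subseteq> topspace Y" "k_omega_space (subtopology Y M)"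
      using bspec[OF Y(1)[unfolded locally_k_omega_space_def] qY] by (elim exE conjE)
    have "k_space (prod_topology (subtopology X N) (subtopology Y M))"
      using X(2) Y(2) UN(5) VM(5) by (intro k_omega_prod_imp_k_space regular_space_subtopology)
    then have k: "k_space (subtopology ?P (N \<times> M))" by (simp add: subtopology_Times)
    have "openin (subtopology ?P (N \<times> M)) (S \<inter> (N \<times> M))"
    proof (rule k[unfolded k_space_open, rule_format], intro conjI allI impI)
      show "S \<inter> (N \<times> M) \<subseteq> topspace (subtopology ?P (N \<times> M))" using S by auto
      fix K assume "compactin (subtopology ?P (N \<times> M)) K"
      then have K: "compactin ?P K" "K \<subseteq> N \<times> M" by (simp_all add: compactin_subtopology)
      have "openin (subtopology ?P K) (K \<inter> S)" using S_open K(1) by blast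
      moreover have "K \<inter> (S \<inter> (N \<times> M)) = K \<inter> S" "(N \<times> M) \<inter> K = K" using K(2) by blast+
      ultimately show "openin (subtopology (subtopology ?P (N \<times> M)) K) (K \<inter> (S \<inter> (N \<times> M)))"
        by (simp add: subtopology_subtopology)
    qed
    then obtain T where T: "openin ?P T" "S \<inter> (N \<times> M) = T \<inter> (N \<times> M)"
      unfolding openin_subtopology by blast
    \<comment> \<open>The k_omega-neighbourhoods \<open>N\<close> and \<open>M\<close> need not be
      open; cutting down to \<open>U \<times> V\<close> gives a set open in the whole
      product.\<close>
    have "openin ?P (T \<inter> (U \<times> V))"
      using T(1) UN(1) VM(1) by (intro openin_Int) (simp_all add: openin_prod_Times_iff)
    moreover have "U \<times> V \<subseteq> N \<times> M" using UN(3) VM(3) by blast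
    then have "T \<inter> (U \<times> V) \<subseteq> S" "v \<in> T \<inter> (U \<times> V)"
      using T(2) v UN(2) VM(2) by (auto simp: pq)
    ultimately show "\<exists>T. openin ?P T \<and> v \<in> T \<and> T \<subseteq> S" by blast
  qed
qed

lemma tanaka_conditions_imp_kR_space:
  assumes X: "tychonoff_space X" and Y: "tychonoff_space Y" and T: "tanaka_conditions X Y"
  shows "kR_space (prod_topology X Y)"
proof (rule k_space_imp_kR_space)
  show P: "tychonoff_space (prod_topology X Y)" using X Y by (rule tychonoff_space_prod_topology)
  have reg: "regular_space X" "regular_space Y"
    using X Y by (simp_all add: tychonoff_space_def completely_regular_imp_regular_space)
  consider "first_countable X" "first_countable Y" | "k_space X" "k_space Y" "locally_compact_space X"
    | "k_space X" "k_space Y" "locally_compact_space Y" | "locally_k_omega_space X" "locally_k_omega_space Y"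
    using T unfolding tanaka_conditions_def by blast
  then show "k_space (prod_topology X Y)"
  proof cases
    case 1
    then show ?thesis
      by (rule first_countable_prod_imp_k_space[OF _ _ tychonoff_imp_Hausdorff[OF P]])
  next
    case 2
    then show ?thesis using reg by (intro k_space_prod_topology_left) auto
  next
    case 3
    then show ?thesis using reg by (intro k_space_prod_topology_right) auto
  next
    case 4
    then show ?thesis using reg by (intro locally_k_omega_prod_imp_k_space)
  qed
qed

lemma kR_space_prod_topology_swap:
  fixes X :: "'a topology" and Y :: "'b topology"
  assumes "kR_space (prod_topology X Y)" "tychonoff_space (prod_topology Y X)"
  shows "kR_space (prod_topology Y X)"
  unfolding kR_space_def
proof (intro conjI allI impI)
  show "tychonoff_space (prod_topology Y X)" by fact
  fix f :: "'b \<times> 'a \<Rightarrow> real"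
  assume f: "\<forall>K. compactin (prod_topology Y X) K \<longrightarrow> continuous_map (subtopology (prod_topology Y X) K) euclideanreal f"
  have sw: "continuous_map (prod_topology A B) (prod_topology B A) prod.swap"
    for A :: "'c topology" and B :: "'d topology"
    unfolding prod.swap_def by (intro continuous_map_pairedI continuous_map_fst continuous_map_snd)
  have "continuous_map (subtopology (prod_topology X Y) K) euclideanreal (f \<circ> prod.swap)"
    if K: "compactin (prod_topology X Y) K" for K
  proof (rule continuous_map_compose)
    have "compactin (prod_topology Y X) (prod.swap ` K)" by (rule image_compactin[OF K sw])
    then show "continuous_map (subtopology (prod_topology Y X) (prod.swap ` K)) euclideanreal f"
      using f by blast
    show "continuous_map (subtopology (prod_topology X Y) K) (subtopology (prod_topology Y X) (prod.swap ` K)) prod.swap"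
      by (intro continuous_map_into_subtopology continuous_map_from_subtopology sw) auto
  qed
  then have "continuous_map (prod_topology X Y) euclideanreal (f \<circ> prod.swap)"
    using assms(1) unfolding kR_space_def by blast
  then have "continuous_map (prod_topology Y X) euclideanreal (f \<circ> prod.swap \<circ> prod.swap)"
    by (rule continuous_map_compose[OF sw])
  then show "continuous_map (prod_topology Y X) euclideanreal f"
    by (simp add: comp_assoc)
qed

section \<open>Fans inside the factors and the three statements\<close>

context stratifiable_k_space
begin

lemma not_first_countable_factor_imp_jointly_locally_bounded:
  assumes "\<not> first_countable X" "k_network X \<P>" "point_countable X \<P>" "kR_space (prod_topology X Y)"
  shows "jointly_locally_bounded Y (UNIV :: nat set)"
proof -
  have "\<exists>K y. sequence_fan X K y"
    using no_sequence_fan_imp_first_countable[OF _ assms(2,3)] assms(1) by blast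
  then obtain K y where y: "sequence_fan X K y" by blast
  obtain x \<psi> where "bump_fan X (UNIV :: nat set) K x \<psi>"
    by (rule sequence_fan_imp_bump_fan[OF y])
  then show ?thesis by (rule bump_fan_kR_prod_imp_jointly_locally_bounded[OF _ assms(4)])
qed

end

theorem theorem3p9:
  assumes "bounding_number \<le>o omega1"
  shows
    "(\<forall>X :: 'a topology.
        tychonoff_space X \<and> stratifiable_space X \<and> k_space X \<and>
        (\<exists>\<P>. k_network X \<P> \<and> point_countable X \<P>) \<and>
        kR_space (prod_topology S_omega X) \<longrightarrow>
          locally_sigma_compact_space X \<and>
          ((\<exists>\<P>. k_network X \<P> \<and> compact_countable X \<P>) \<longrightarrow> locally_k_omega_space X)) \<and>
     (\<forall>X :: 'a topology.
        tychonoff_space X \<and> stratifiable_space X \<and> k_space X \<and>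
        (\<exists>\<P>. k_network X \<P> \<and> point_countable X \<P>) \<and>
        kR_space (prod_topology S_omega1 X) \<longrightarrow>
          locally_compact_space X) \<and>
     (\<forall>(X :: 'a topology) (Y :: 'b topology).
        tychonoff_space X \<and> stratifiable_space X \<and> k_space X \<and>
        (\<exists>\<P>. k_network X \<P> \<and> compact_countable X \<P>) \<and>
        tychonoff_space Y \<and> stratifiable_space Y \<and> k_space Y \<and>
        (\<exists>\<P>. k_network Y \<P> \<and> compact_countable Y \<P>) \<longrightarrow>
          (kR_space (prod_topology X Y) \<longleftrightarrow> tanaka_conditions X Y))"
proof -
  obtain H where H: "unbounded_family H" "|H| \<le>o omega1"
    using bounding_number(1) assms by metis
  show ?thesis
  proof (intro conjI allI impI; (elim conjE)?)
    fix X :: "'a topology"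
    assume "tychonoff_space X" "stratifiable_space X" "k_space X"
      and net: "\<exists>\<P>. k_network X \<P> \<and> point_countable X \<P>"
      and kR: "kR_space (prod_topology S_omega X)"
    then interpret stratifiable_k_space X by unfold_locales
    have jlb: "jointly_locally_bounded X (UNIV :: nat set)"
      by (rule bump_fan_kR_prod_imp_jointly_locally_bounded[OF bump_fan_sequential_fan kR]) simp
    show "locally_sigma_compact_space X"
      using net jointly_locally_bounded_imp_locally_sigma_compact[OF H jlb] by blast
    show "locally_k_omega_space X" if "\<exists>\<P>. k_network X \<P> \<and> compact_countable X \<P>"
      using that jointly_locally_bounded_imp_locally_k_omega[OF H jlb] by blast
  next
    fix X :: "'a topology"
    assume "tychonoff_space X" "stratifiable_space X" "k_space X"
      and net: "\<exists>\<P>. k_network X \<P> \<and> point_countable X \<P>"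
      and kR: "kR_space (prod_topology S_omega1 X)"
    then interpret stratifiable_k_space X by unfold_locales
    have jlb: "jointly_locally_bounded X (Field omega1)"
      by (rule bump_fan_kR_prod_imp_jointly_locally_bounded[OF bump_fan_sequential_fan kR])
        (rule Field_cardSuc_not_empty[OF natLeq_Card_order])
    have F: "omega1 =o |Field omega1|"
      by (rule ordIso_symmetric[OF card_of_Field_ordIso[OF cardSuc_Card_order[OF natLeq_Card_order]]])
    have "|UNIV :: nat set| \<le>o omega1"
      using ordIso_ordLeq_trans[OF card_of_nat cardSuc_ordLeq[OF natLeq_Card_order]] .
    then have jlb_nat: "jointly_locally_bounded X (UNIV :: nat set)"
      by (rule jointly_locally_bounded_mono[OF jlb ordLeq_ordIso_trans[OF _ F]])
    have jlb_H: "jointly_locally_bounded X H"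
      by (rule jointly_locally_bounded_mono[OF jlb ordLeq_ordIso_trans[OF H(2) F]])
    \<comment> \<open>Boundedness over \<open>H\<close> excludes fans; boundedness over the natural
      numbers then turns first-countability into local compactness.\<close>
    have "first_countable X"
      using net no_sequence_fan_imp_first_countable
        sequence_fan_imp_not_jointly_locally_bounded[OF _ H(1)] jlb_H by blast
    then show "locally_compact_space X"
      by (rule first_countable_jointly_locally_bounded_imp_locally_compact[OF _ jlb_nat])
  next
    fix X :: "'a topology" and Y :: "'b topology"
    assume X: "tychonoff_space X" "stratifiable_space X" "k_space X"
      and net_X: "\<exists>\<P>. k_network X \<P> \<and> compact_countable X \<P>"
      and Y: "tychonoff_space Y" "stratifiable_space Y" "k_space Y"
      and net_Y: "\<exists>\<P>. k_network Y \<P> \<and> compact_countable Y \<P>"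
    interpret X: stratifiable_k_space X using X by unfold_locales
    interpret Y: stratifiable_k_space Y using Y by unfold_locales
    obtain \<P> where \<P>: "k_network X \<P>" "compact_countable X \<P>" using net_X by blast
    obtain \<Q> where \<Q>: "k_network Y \<Q>" "compact_countable Y \<Q>" using net_Y by blast
    show "kR_space (prod_topology X Y) \<longleftrightarrow> tanaka_conditions X Y"
    proof
      assume kR: "kR_space (prod_topology X Y)"
      \<comment> \<open>The fan lemma has the fan in the left factor, so fans in \<open>Y\<close>
        require the swapped product.\<close>
      have kR': "kR_space (prod_topology Y X)"
        by (rule kR_space_prod_topology_swap[OF kR tychonoff_space_prod_topology[OF Y(1) X(1)]])
      have jlb_Y: "jointly_locally_bounded Y (UNIV :: nat set)" if "\<not> first_countable X"
        by (rule X.not_first_countable_factor_imp_jointly_locally_bounded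
            [OF that \<P>(1) compact_countable_imp_point_countable[OF \<P>(2)] kR])
      have jlb_X: "jointly_locally_bounded X (UNIV :: nat set)" if "\<not> first_countable Y"
        by (rule Y.not_first_countable_factor_imp_jointly_locally_bounded
            [OF that \<Q>(1) compact_countable_imp_point_countable[OF \<Q>(2)] kR'])
      \<comment> \<open>A factor that is not first-countable contains a fan and so bounds the other
        one. That other factor becomes locally compact if it is first-countable; if neither is, each
        makes the other locally k_omega.\<close>
      consider "first_countable X" "first_countable Y" | "first_countable X" "\<not> first_countable Y"
        | "\<not> first_countable X" "first_countable Y" | "\<not> first_countable X" "\<not> first_countable Y"
        by blast
      then show "tanaka_conditions X Y"
      proof cases
        case 1
        then show ?thesis by (simp add: tanaka_conditions_def)
      next
        case 2
        then have "locally_compact_space X"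
          using X.first_countable_jointly_locally_bounded_imp_locally_compact jlb_X by blast
        then show ?thesis using X(3) Y(3) by (simp add: tanaka_conditions_def)
      next
        case 3
        then have "locally_compact_space Y"
          using Y.first_countable_jointly_locally_bounded_imp_locally_compact jlb_Y by blast
        then show ?thesis using X(3) Y(3) by (simp add: tanaka_conditions_def)
      next
        case 4
        then have "locally_k_omega_space X" "locally_k_omega_space Y"
          using X.jointly_locally_bounded_imp_locally_k_omega[OF H jlb_X \<P>]
            Y.jointly_locally_bounded_imp_locally_k_omega[OF H jlb_Y \<Q>] by blast+
        then show ?thesis by (simp add: tanaka_conditions_def)
      qed
    next
      assume "tanaka_conditions X Y"
      then show "kR_space (prod_topology X Y)"
        by (rule tanaka_conditions_imp_kR_space[OF X(1) Y(1)])
    qed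
  qed
qed

end
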